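(* Let $G$ and $\mu$ be as in the context, and let $\phi(x)$ be a formula such that $\phi^\ell(x;y):=\phi(y\cdot x)$ is NIP. Suppose $\nu$ is a left invariant finitely additive probability measure defined on some Boolean algebra $\mathcal{B}$ of subsets of $G$ containing all left translates $g\phi(G)$, $g\in G$, of $\phi(G)$ (left invariant meaning $\nu(gX)=\nu(X)$ whenever $X,gX\in\mathcal{B}$). Then $\nu(\phi(x))=\mu(\phi(x))$.
   Context: Let $\mathcal{L}$ be a first-order language expanding the language of groups. Expand $\mathcal{L}$ to $\mathcal{L}^+$ by a new sort $\mathcal{I}$ with a binary relation $<$, a binary function $d$, and, for each $\mathcal{L}$-formula $\phi(\bar x;\bar y)$, a function symbol $\mu_\phi(\bar y)$ into $\mathcal{I}$; each finite $\mathcal{L}$-structure $A$ becomes an $\mathcal{L}^+$-structure by interpreting $\mathcal{I}$ as $[0,1]$ with its order and $d(s,t)=|s-t|$, and $\mu_\phi(\bar b)$ as $|\phi(A^{\bar x},\bar b)|/|A|^{|\bar x|}$. $G$ is a sufficiently saturated elementary extension of an ultraproduct of finite groups (expanded to $\mathcal{L}^+$-structures in this way). "Formula" means $\mathcal{L}$-formula with parameters from $G$. The pseudofinite counting measure is $\mu(\phi(\bar x,\bar b))=$ standard part of $\mu_\phi(\bar b)$. A formula $\psi(\bar x;\bar y)$ is NIP if for some $k$ there are no $(\bar a_i)_{i\in[k]}$, $(\bar b_X)_{X\subseteq[k]}$ with $G\models\psi(\bar a_i,\bar b_X)\iff i\in X$. *)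

theory Defs
  imports Complex_Main "HOL-Algebra.Group"
begin

datatype 'f trm = Var nat | Fn 'f "'f trm list"

datatype ('f, 'r) fm =
    Eq "'f trm" "'f trm"
  | Rel 'r "'f trm list"
  | Neg "('f, 'r) fm"
  | Conj "('f, 'r) fm" "('f, 'r) fm"
  | Ex nat "('f, 'r) fm"

fun wf_trm :: "('f \<Rightarrow> nat) \<Rightarrow> 'f trm \<Rightarrow> bool" where
  "wf_trm ar (Var n) = True"
| "wf_trm ar (Fn f ts) = (length ts = ar f \<and> (\<forall>t\<in>set ts. wf_trm ar t))"

fun wf_fm :: "('f \<Rightarrow> nat) \<Rightarrow> ('r \<Rightarrow> nat) \<Rightarrow> ('f, 'r) fm \<Rightarrow> bool" where
  "wf_fm ar rar (Eq s t) = (wf_trm ar s \<and> wf_trm ar t)"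
| "wf_fm ar rar (Rel r ts) = (length ts = rar r \<and> (\<forall>t\<in>set ts. wf_trm ar t))"
| "wf_fm ar rar (Neg \<phi>) = wf_fm ar rar \<phi>"
| "wf_fm ar rar (Conj \<phi> \<psi>) = (wf_fm ar rar \<phi> \<and> wf_fm ar rar \<psi>)"
| "wf_fm ar rar (Ex n \<phi>) = wf_fm ar rar \<phi>"

fun fv_trm :: "'f trm \<Rightarrow> nat set" where
  "fv_trm (Var n) = {n}"
| "fv_trm (Fn f ts) = (\<Union>t\<in>set ts. fv_trm t)"

fun fv_fm :: "('f, 'r) fm \<Rightarrow> nat set" where
  "fv_fm (Eq s t) = fv_trm s \<union> fv_trm t"
| "fv_fm (Rel r ts) = (\<Union>t\<in>set ts. fv_trm t)"
| "fv_fm (Neg \<phi>) = fv_fm \<phi>"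
| "fv_fm (Conj \<phi> \<psi>) = fv_fm \<phi> \<union> fv_fm \<psi>"
| "fv_fm (Ex n \<phi>) = fv_fm \<phi> - {n}"

fun evt :: "('f \<Rightarrow> 'a list \<Rightarrow> 'a) \<Rightarrow> (nat \<Rightarrow> 'a) \<Rightarrow> 'f trm \<Rightarrow> 'a" where
  "evt F e (Var n) = e n"
| "evt F e (Fn f ts) = F f (map (evt F e) ts)"

fun satL :: "'a set \<Rightarrow> ('f \<Rightarrow> 'a list \<Rightarrow> 'a) \<Rightarrow> ('r \<Rightarrow> 'a list \<Rightarrow> bool)
    \<Rightarrow> (nat \<Rightarrow> 'a) \<Rightarrow> ('f, 'r) fm \<Rightarrow> bool" where
  "satL D F R e (Eq s t) = (evt F e s = evt F e t)"
| "satL D F R e (Rel r ts) = R r (map (evt F e) ts)"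
| "satL D F R e (Neg \<phi>) = (\<not> satL D F R e \<phi>)"
| "satL D F R e (Conj \<phi> \<psi>) = (satL D F R e \<phi> \<and> satL D F R e \<psi>)"
| "satL D F R e (Ex n \<phi>) = (\<exists>a\<in>D. satL D F R (e(n := a)) \<phi>)"

definition lstruct_ok :: "('f \<Rightarrow> nat) \<Rightarrow> 'a set \<Rightarrow> ('f \<Rightarrow> 'a list \<Rightarrow> 'a) \<Rightarrow> bool" where
  "lstruct_ok ar D F \<longleftrightarrow> D \<noteq> {} \<and>
     (\<forall>f as. length as = ar f \<and> set as \<subseteq> D \<longrightarrow> F f as \<in> D)"

definition group_lang :: "('f \<Rightarrow> nat) \<Rightarrow> 'f \<Rightarrow> 'f \<Rightarrow> 'f \<Rightarrow> bool" where
  "group_lang ar mulS invS oneS \<longleftrightarrow> ar mulS = 2 \<and> ar invS = 1 \<and> ar oneS = 0 \<and>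
     mulS \<noteq> invS \<and> mulS \<noteq> oneS \<and> invS \<noteq> oneS"

definition group_of :: "'a set \<Rightarrow> ('f \<Rightarrow> 'a list \<Rightarrow> 'a) \<Rightarrow> 'f \<Rightarrow> 'f \<Rightarrow> 'a monoid" where
  "group_of D F mulS oneS = \<lparr>carrier = D, mult = (\<lambda>x y. F mulS [x, y]), one = F oneS []\<rparr>"

definition group_interp :: "'a set \<Rightarrow> ('f \<Rightarrow> 'a list \<Rightarrow> 'a) \<Rightarrow> 'f \<Rightarrow> 'f \<Rightarrow> 'f \<Rightarrow> bool" where
  "group_interp D F mulS invS oneS \<longleftrightarrow> group (group_of D F mulS oneS) \<and>
     (\<forall>x\<in>D. F invS [x] = inv\<^bsub>group_of D F mulS oneS\<^esub> x)"

text \<open>Terms of the sort I: variables of sort I, the distance function d, and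
the function symbols mu_phi(y) for an L-formula phi(x;y).  Here Mu phi n ts
stands for mu_phi applied to the tuple ts, where the variables 0..n-1 of phi are
the counted variables x and the variables n..n+length ts - 1 are the
parameter variables y.\<close>

datatype ('f, 'r) itrm =
    IVar nat
  | Dist "('f, 'r) itrm" "('f, 'r) itrm"
  | Mu "('f, 'r) fm" nat "'f trm list"

datatype ('f, 'r) pfm =
    PEq "'f trm" "'f trm"
  | PRel 'r "'f trm list"
  | IEq "('f, 'r) itrm" "('f, 'r) itrm"
  | ILess "('f, 'r) itrm" "('f, 'r) itrm"
  | PNeg "('f, 'r) pfm"
  | PConj "('f, 'r) pfm" "('f, 'r) pfm"
  | PExG nat "('f, 'r) pfm"
  | PExI nat "('f, 'r) pfm"

fun wf_itrm :: "('f \<Rightarrow> nat) \<Rightarrow> ('r \<Rightarrow> nat) \<Rightarrow> ('f, 'r) itrm \<Rightarrow> bool" where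
  "wf_itrm ar rar (IVar n) = True"
| "wf_itrm ar rar (Dist s t) = (wf_itrm ar rar s \<and> wf_itrm ar rar t)"
| "wf_itrm ar rar (Mu \<phi> n ts) = (wf_fm ar rar \<phi> \<and> fv_fm \<phi> \<subseteq> {..< n + length ts} \<and>
      (\<forall>t\<in>set ts. wf_trm ar t))"

fun wf_pfm :: "('f \<Rightarrow> nat) \<Rightarrow> ('r \<Rightarrow> nat) \<Rightarrow> ('f, 'r) pfm \<Rightarrow> bool" where
  "wf_pfm ar rar (PEq s t) = (wf_trm ar s \<and> wf_trm ar t)"
| "wf_pfm ar rar (PRel r ts) = (length ts = rar r \<and> (\<forall>t\<in>set ts. wf_trm ar t))"
| "wf_pfm ar rar (IEq s t) = (wf_itrm ar rar s \<and> wf_itrm ar rar t)"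
| "wf_pfm ar rar (ILess s t) = (wf_itrm ar rar s \<and> wf_itrm ar rar t)"
| "wf_pfm ar rar (PNeg \<phi>) = wf_pfm ar rar \<phi>"
| "wf_pfm ar rar (PConj \<phi> \<psi>) = (wf_pfm ar rar \<phi> \<and> wf_pfm ar rar \<psi>)"
| "wf_pfm ar rar (PExG n \<phi>) = wf_pfm ar rar \<phi>"
| "wf_pfm ar rar (PExI n \<phi>) = wf_pfm ar rar \<phi>"

record ('a, 'b, 'f, 'r) pstruct =
  domG :: "'a set"
  domI :: "'b set"
  fnG :: "'f \<Rightarrow> 'a list \<Rightarrow> 'a"
  relG :: "'r \<Rightarrow> 'a list \<Rightarrow> bool"
  lessI :: "'b \<Rightarrow> 'b \<Rightarrow> bool"
  dI :: "'b \<Rightarrow> 'b \<Rightarrow> 'b"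
  muI :: "('f, 'r) fm \<Rightarrow> nat \<Rightarrow> 'a list \<Rightarrow> 'b"

fun evi :: "('a, 'b, 'f, 'r) pstruct \<Rightarrow> (nat \<Rightarrow> 'a) \<Rightarrow> (nat \<Rightarrow> 'b) \<Rightarrow> ('f, 'r) itrm \<Rightarrow> 'b" where
  "evi S eg ei (IVar n) = ei n"
| "evi S eg ei (Dist s t) = dI S (evi S eg ei s) (evi S eg ei t)"
| "evi S eg ei (Mu \<phi> n ts) = muI S \<phi> n (map (evt (fnG S) eg) ts)"

fun psat :: "('a, 'b, 'f, 'r) pstruct \<Rightarrow> (nat \<Rightarrow> 'a) \<Rightarrow> (nat \<Rightarrow> 'b) \<Rightarrow> ('f, 'r) pfm \<Rightarrow> bool" where
  "psat S eg ei (PEq s t) = (evt (fnG S) eg s = evt (fnG S) eg t)"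
| "psat S eg ei (PRel r ts) = relG S r (map (evt (fnG S) eg) ts)"
| "psat S eg ei (IEq s t) = (evi S eg ei s = evi S eg ei t)"
| "psat S eg ei (ILess s t) = lessI S (evi S eg ei s) (evi S eg ei t)"
| "psat S eg ei (PNeg \<phi>) = (\<not> psat S eg ei \<phi>)"
| "psat S eg ei (PConj \<phi> \<psi>) = (psat S eg ei \<phi> \<and> psat S eg ei \<psi>)"
| "psat S eg ei (PExG n \<phi>) = (\<exists>a\<in>domG S. psat S (eg(n := a)) ei \<phi>)"
| "psat S eg ei (PExI n \<phi>) = (\<exists>b\<in>domI S. psat S eg (ei(n := b)) \<phi>)"

definition pstruct_ok :: "('f \<Rightarrow> nat) \<Rightarrow> ('r \<Rightarrow> nat) \<Rightarrow> ('a, 'b, 'f, 'r) pstruct \<Rightarrow> bool" where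
  "pstruct_ok ar rar S \<longleftrightarrow> lstruct_ok ar (domG S) (fnG S) \<and> domI S \<noteq> {} \<and>
     (\<forall>s\<in>domI S. \<forall>t\<in>domI S. dI S s t \<in> domI S) \<and>
     (\<forall>\<phi> n bs. wf_fm ar rar \<phi> \<and> fv_fm \<phi> \<subseteq> {..< n + length bs} \<and> set bs \<subseteq> domG S
        \<longrightarrow> muI S \<phi> n bs \<in> domI S)"

definition fenv :: "'a set \<Rightarrow> nat \<Rightarrow> 'a list \<Rightarrow> 'a list \<Rightarrow> nat \<Rightarrow> 'a" where
  "fenv D n as bs k = (if k < n then as ! k
      else if k - n < length bs then bs ! (k - n) else (SOME x. x \<in> D))"

definition fin_mu :: "'a set \<Rightarrow> ('f \<Rightarrow> 'a list \<Rightarrow> 'a) \<Rightarrow> ('r \<Rightarrow> 'a list \<Rightarrow> bool)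
    \<Rightarrow> ('f, 'r) fm \<Rightarrow> nat \<Rightarrow> 'a list \<Rightarrow> real" where
  "fin_mu D F R \<phi> n bs =
     real (card {as. length as = n \<and> set as \<subseteq> D \<and> satL D F R (fenv D n as bs) \<phi>})
     / real (card D) ^ n"

definition fin_plus :: "'a set \<Rightarrow> ('f \<Rightarrow> 'a list \<Rightarrow> 'a) \<Rightarrow> ('r \<Rightarrow> 'a list \<Rightarrow> bool)
    \<Rightarrow> ('a, real, 'f, 'r) pstruct" where
  "fin_plus D F R = \<lparr>domG = D, domI = {0..1}, fnG = F, relG = R, lessI = (<),
     dI = (\<lambda>s t. \<bar>s - t\<bar>), muI = fin_mu D F R\<rparr>"

definition ultrafilter_on :: "'i set set \<Rightarrow> bool" where
  "ultrafilter_on U \<longleftrightarrow> UNIV \<in> U \<and> {} \<notin> U \<and>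
     (\<forall>A B. A \<in> U \<and> A \<subseteq> B \<longrightarrow> B \<in> U) \<and>
     (\<forall>A B. A \<in> U \<and> B \<in> U \<longrightarrow> A \<inter> B \<in> U) \<and>
     (\<forall>A. A \<in> U \<or> - A \<in> U)"

definition ucls :: "'i set set \<Rightarrow> ('i \<Rightarrow> 'a) set \<Rightarrow> ('i \<Rightarrow> 'a) \<Rightarrow> ('i \<Rightarrow> 'a) set" where
  "ucls U S f = {g \<in> S. {i. f i = g i} \<in> U}"

definition rep :: "('i \<Rightarrow> 'a) set \<Rightarrow> 'i \<Rightarrow> 'a" where
  "rep c = (SOME g. g \<in> c)"

definition Dfun :: "('i \<Rightarrow> 'a set) \<Rightarrow> ('i \<Rightarrow> 'a) set" where
  "Dfun D = {f. \<forall>i. f i \<in> D i}"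

definition Ifun :: "('i \<Rightarrow> real) set" where
  "Ifun = {f. \<forall>i. f i \<in> {0..1}}"

definition ultraprod :: "('i \<Rightarrow> 'a set) \<Rightarrow> ('i \<Rightarrow> 'f \<Rightarrow> 'a list \<Rightarrow> 'a)
    \<Rightarrow> ('i \<Rightarrow> 'r \<Rightarrow> 'a list \<Rightarrow> bool) \<Rightarrow> 'i set set
    \<Rightarrow> (('i \<Rightarrow> 'a) set, ('i \<Rightarrow> real) set, 'f, 'r) pstruct" where
  "ultraprod D F R U = \<lparr>
     domG = ucls U (Dfun D) ` Dfun D,
     domI = ucls U Ifun ` Ifun,
     fnG = (\<lambda>f cs. ucls U (Dfun D) (\<lambda>i. fnG (fin_plus (D i) (F i) (R i)) f (map (\<lambda>c. rep c i) cs))),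
     relG = (\<lambda>r cs. {i. relG (fin_plus (D i) (F i) (R i)) r (map (\<lambda>c. rep c i) cs)} \<in> U),
     lessI = (\<lambda>s t. {i. lessI (fin_plus (D i) (F i) (R i)) (rep s i) (rep t i)} \<in> U),
     dI = (\<lambda>s t. ucls U Ifun (\<lambda>i. dI (fin_plus (D i) (F i) (R i)) (rep s i) (rep t i))),
     muI = (\<lambda>\<phi> n cs. ucls U Ifun (\<lambda>i. muI (fin_plus (D i) (F i) (R i)) \<phi> n (map (\<lambda>c. rep c i) cs)))\<rparr>"

definition elem_emb :: "('f \<Rightarrow> nat) \<Rightarrow> ('r \<Rightarrow> nat) \<Rightarrow> ('a, 'b, 'f, 'r) pstruct
    \<Rightarrow> ('c, 'd, 'f, 'r) pstruct \<Rightarrow> ('a \<Rightarrow> 'c) \<Rightarrow> ('b \<Rightarrow> 'd) \<Rightarrow> bool" where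
  "elem_emb ar rar S T hG hI \<longleftrightarrow> hG ` domG S \<subseteq> domG T \<and> hI ` domI S \<subseteq> domI T \<and>
     (\<forall>\<psi> eg ei. wf_pfm ar rar \<psi> \<and> range eg \<subseteq> domG S \<and> range ei \<subseteq> domI S \<longrightarrow>
        (psat S eg ei \<psi> \<longleftrightarrow> psat T (hG \<circ> eg) (hI \<circ> ei) \<psi>))"

text \<open>|L+|^+-saturation: every finitely satisfiable set of L+-formulas in the
variable 0 (of either sort) with parameters from a set of size at most |L+|
(= number of L+-formulas) is realized.\<close>

definition saturated :: "('f \<Rightarrow> nat) \<Rightarrow> ('r \<Rightarrow> nat) \<Rightarrow> ('a, 'b, 'f, 'r) pstruct \<Rightarrow> bool" where
  "saturated ar rar S \<longleftrightarrow>
    (\<forall>(\<Sigma> :: (('f, 'r) pfm \<times> (nat \<Rightarrow> 'a) \<times> (nat \<Rightarrow> 'b)) set) A B.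
      A \<subseteq> domG S \<and> B \<subseteq> domI S \<and>
      (\<exists>f :: 'a \<Rightarrow> ('f, 'r) pfm. inj_on f A) \<and> (\<exists>f :: 'b \<Rightarrow> ('f, 'r) pfm. inj_on f B) \<and>
      (\<forall>(\<psi>, eg, ei)\<in>\<Sigma>. wf_pfm ar rar \<psi> \<and> range eg \<subseteq> A \<and> range ei \<subseteq> B) \<longrightarrow>
      ((\<forall>\<Sigma>0\<subseteq>\<Sigma>. finite \<Sigma>0 \<longrightarrow> (\<exists>c\<in>domG S. \<forall>(\<psi>, eg, ei)\<in>\<Sigma>0. psat S (eg(0 := c)) ei \<psi>))
         \<longrightarrow> (\<exists>c\<in>domG S. \<forall>(\<psi>, eg, ei)\<in>\<Sigma>. psat S (eg(0 := c)) ei \<psi>)) \<and>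
      ((\<forall>\<Sigma>0\<subseteq>\<Sigma>. finite \<Sigma>0 \<longrightarrow> (\<exists>c\<in>domI S. \<forall>(\<psi>, eg, ei)\<in>\<Sigma>0. psat S eg (ei(0 := c)) \<psi>))
         \<longrightarrow> (\<exists>c\<in>domI S. \<forall>(\<psi>, eg, ei)\<in>\<Sigma>. psat S eg (ei(0 := c)) \<psi>)))"

definition defset :: "('a, 'b, 'f, 'r) pstruct \<Rightarrow> ('f, 'r) fm \<Rightarrow> (nat \<Rightarrow> 'a) \<Rightarrow> 'a set" where
  "defset S \<phi> e = {a \<in> domG S. satL (domG S) (fnG S) (relG S) (e(0 := a)) \<phi>}"

definition ltrans :: "('a, 'b, 'f, 'r) pstruct \<Rightarrow> 'f \<Rightarrow> 'a \<Rightarrow> 'a set \<Rightarrow> 'a set" where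
  "ltrans S mulS g X = (\<lambda>x. fnG S mulS [g, x]) ` X"

definition nfv :: "('f, 'r) fm \<Rightarrow> nat" where
  "nfv \<phi> = Suc (Max (insert 0 (fv_fm \<phi>)))"

text \<open>The standard part of an element t of sort I, where the real r in [0,1]
is identified with the image under hI of the class of the constant sequence r.\<close>

definition std_part :: "('a, 'b, 'f, 'r) pstruct \<Rightarrow> 'i set set \<Rightarrow> (('i \<Rightarrow> real) set \<Rightarrow> 'b)
    \<Rightarrow> 'b \<Rightarrow> real" where
  "std_part S U hI t = Sup {r \<in> {0..1}. \<not> lessI S t (hI (ucls U Ifun (\<lambda>i. r)))}"

definition pf_measure :: "('a, 'b, 'f, 'r) pstruct \<Rightarrow> 'i set set \<Rightarrow> (('i \<Rightarrow> real) set \<Rightarrow> 'b)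
    \<Rightarrow> ('f, 'r) fm \<Rightarrow> (nat \<Rightarrow> 'a) \<Rightarrow> real" where
  "pf_measure S U hI \<phi> e = std_part S U hI (muI S \<phi> 1 (map e [1..<nfv \<phi>]))"

definition NIP_rel :: "'a set \<Rightarrow> ('a \<Rightarrow> 'a \<Rightarrow> bool) \<Rightarrow> bool" where
  "NIP_rel D P \<longleftrightarrow> (\<exists>k::nat. \<not> (\<exists>a b. (\<forall>i<k. a i \<in> D) \<and> (\<forall>X. X \<subseteq> {..<k} \<longrightarrow> b X \<in> D) \<and>
      (\<forall>i<k. \<forall>X. X \<subseteq> {..<k} \<longrightarrow> (P (a i) (b X) \<longleftrightarrow> i \<in> X))))"

definition bool_alg :: "'a set \<Rightarrow> 'a set set \<Rightarrow> bool" where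
  "bool_alg \<Omega> B \<longleftrightarrow> B \<subseteq> Pow \<Omega> \<and> {} \<in> B \<and> (\<forall>X\<in>B. \<Omega> - X \<in> B) \<and>
     (\<forall>X\<in>B. \<forall>Y\<in>B. X \<union> Y \<in> B)"

definition fin_add_prob :: "'a set \<Rightarrow> 'a set set \<Rightarrow> ('a set \<Rightarrow> real) \<Rightarrow> bool" where
  "fin_add_prob \<Omega> B \<nu> \<longleftrightarrow> (\<forall>X\<in>B. 0 \<le> \<nu> X) \<and> \<nu> \<Omega> = 1 \<and>
     (\<forall>X\<in>B. \<forall>Y\<in>B. X \<inter> Y = {} \<longrightarrow> \<nu> (X \<union> Y) = \<nu> X + \<nu> Y)"

end

theory Submission
  imports Defs "HOL-Library.FuncSet" "HOL-Real_Asymp.Real_Asymp"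
begin

text \<open>
  Let \<open>X = \<phi>(G)\<close>. By NIP the family of sets \<open>{y. y g \<in> X}\<close>, i.e. of the right translates of \<open>X\<close>, has
  finite VC dimension, so by the uniform law of large numbers of Vapnik and Chervonenkis every
  finite group of the ultraproduct contains \<open>b\<^sub>0, \<dots>, b\<^sub>N\<^sub>-\<^sub>1\<close>, with \<open>N\<close> independent of the group, such that
  for every \<open>g\<close> the proportion of \<open>j\<close> with \<open>b\<^sub>j g \<in> X\<close> is within \<open>\<epsilon>\<close> of the density of \<open>X\<close>. This is
  expressible in the language with the counting functions and hence passes to \<open>G\<close>: there the average
  of the indicator functions of the translates \<open>b\<^sub>j\<^sup>-\<^sup>1 X\<close> is within \<open>\<epsilon>\<close> of \<open>\<mu> X\<close> everywhere. As \<open>\<nu>\<close> is left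
  invariant, the \<open>\<nu>\<close>-integral of this average is \<open>\<nu> X\<close>.
\<close>

section \<open>The Sauer--Shelah lemma\<close>

text \<open>NIP is known in G only, while a finite group may well contain the excluded pattern. The
  transferred sentence is therefore an implication, closed over all parameters: if there is no
  pattern of length k and the density lies on a given side of a real r, then there is a uniform
  sample of length N. The sort I has neither addition nor names for reals. So r enters as the value
  of an I-variable, and the approximation is not written as an inequality: for fixed N it is a
  condition on which subsets of \<open>{..<N}\<close> occur, hence a finite combination of
  L-formulas. One comparison with r yields a one-sided estimate only. Estimates of \<nu> are thus
  made for a factor s, used with s = 1 and s = -1, with r near the standard part on either side. A
  law of large numbers for a single translate would not do: the same b_j must serve every g, because
  the averaged function has to be nearly constant before an otherwise unknown \<nu> can integrate
  it.\<close>

definition shatters :: "'a set set \<Rightarrow> 'a set \<Rightarrow> bool" where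
  "shatters H S \<longleftrightarrow> (\<forall>X\<subseteq>S. \<exists>Y\<in>H. Y \<inter> S = X)"

text \<open>Pajor's strengthening of Sauer-Shelah. \<open>H0\<close> consists of the traces off
  \<open>a\<close> and \<open>H1\<close> of the traces with two preimages, so their sizes add up to
  \<open>card H\<close>. A set shattered by \<open>H1\<close> remains shattered by \<open>H\<close>
  when \<open>a\<close> is added, and is thus counted apart from the sets shattered by
  \<open>H0\<close>.\<close>

lemma card_le_card_shattered:
  assumes "finite A" "H \<subseteq> Pow A"
  shows "card H \<le> card {S. S \<subseteq> A \<and> shatters H S}"
  using assms
proof (induction A arbitrary: H rule: finite_induct)
  case empty
  show ?case
  proof (cases "H = {}")
    case False
    then have "H = {{}}" using empty by auto
    then have "{S. S \<subseteq> {} \<and> shatters H S} = {{}}" by (auto simp: shatters_def)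
    then show ?thesis using \<open>H = {{}}\<close> by simp
  qed simp
next
  case (insert a A)
  define H0 where "H0 = (\<lambda>X. X - {a}) ` H"
  define H1 where "H1 = {X \<in> H. a \<notin> X \<and> insert a X \<in> H}"
  let ?K0 = "{S. S \<subseteq> A \<and> shatters H0 S}" and ?K1 = "{S. S \<subseteq> A \<and> shatters H1 S}"
  have sub: "H0 \<subseteq> Pow A" "H1 \<subseteq> Pow A" using insert.prems by (auto simp: H0_def H1_def)
  have fin: "finite H" using insert.hyps insert.prems by (meson finite_Pow_iff finite_insert finite_subset)
  have c: "card H = card {X\<in>H. a \<notin> X} + card {X\<in>H. a \<in> X}"
  proof -
    have "card ({X\<in>H. a \<notin> X} \<union> {X\<in>H. a \<in> X}) = card {X\<in>H. a \<notin> X} + card {X\<in>H. a \<in> X}"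
      using fin by (intro card_Un_disjoint) auto
    moreover have "{X\<in>H. a \<notin> X} \<union> {X\<in>H. a \<in> X} = H" by auto
    ultimately show ?thesis by simp
  qed
  let ?B = "(\<lambda>X. X - {a}) ` {X\<in>H. a \<in> X}"
  have inj: "inj_on (\<lambda>X. X - {a}) {X\<in>H. a \<in> X}" by (rule inj_onI) blast
  have "card H0 + card H1 = card H"
  proof -
    have u: "{X\<in>H. a \<notin> X} \<union> ?B = H0"
    proof (intro equalityI subsetI)
      fix Y assume "Y \<in> H0"
      then obtain X where "X \<in> H" "Y = X - {a}" by (auto simp: H0_def)
      then show "Y \<in> {X\<in>H. a \<notin> X} \<union> ?B" by (cases "a \<in> X") auto
    qed (auto simp: H0_def image_iff intro: rev_bexI)
    have i: "{X\<in>H. a \<notin> X} \<inter> ?B = H1"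
    proof (intro equalityI subsetI)
      fix Y assume "Y \<in> H1"
      then have "Y \<in> H" "a \<notin> Y" "insert a Y \<in> H" "Y = insert a Y - {a}" by (auto simp: H1_def)
      then show "Y \<in> {X\<in>H. a \<notin> X} \<inter> ?B" by blast
    qed (auto simp: H1_def insert_absorb)
    show ?thesis using card_Un_Int[of "{X\<in>H. a \<notin> X}" ?B] fin
      unfolding u i by (simp add: c card_image[OF inj])
  qed
  moreover have "card H0 \<le> card ?K0" "card H1 \<le> card ?K1"
    using insert.IH sub by auto
  moreover have "card ?K0 + card ?K1 \<le> card {S. S \<subseteq> insert a A \<and> shatters H S}"
  proof -
    have ij: "inj_on (insert a) ?K1"
      using insert.hyps by (intro inj_onI) (auto dest: insert_ident[THEN iffD1, rotated 2])
    have fA: "finite ?K0" "finite ?K1" using insert.hyps by auto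
    have dj: "?K0 \<inter> insert a ` ?K1 = {}" using insert.hyps by auto
    have s0: "?K0 \<subseteq> {S. S \<subseteq> insert a A \<and> shatters H S}"
    proof clarify
      fix S assume S: "S \<subseteq> A" "shatters H0 S"
      have "a \<notin> S" using S insert.hyps by auto
      have "shatters H S" unfolding shatters_def
      proof (intro allI impI)
        fix X assume "X \<subseteq> S"
        then obtain Y where "Y \<in> H" "(Y - {a}) \<inter> S = X" using S unfolding shatters_def H0_def by blast
        then show "\<exists>Y\<in>H. Y \<inter> S = X" using \<open>a \<notin> S\<close> by blast
      qed
      then show "S \<subseteq> insert a A \<and> shatters H S" using S by auto
    qed
    have s1: "insert a ` ?K1 \<subseteq> {S. S \<subseteq> insert a A \<and> shatters H S}"
    proof clarify
      fix S assume S: "S \<subseteq> A" "shatters H1 S"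
      have "a \<notin> S" using S insert.hyps by auto
      have "shatters H (insert a S)" unfolding shatters_def
      proof (intro allI impI)
        fix X assume X: "X \<subseteq> insert a S"
        then have "X - {a} \<subseteq> S" by auto
        then obtain Y where Y: "Y \<in> H" "a \<notin> Y" "insert a Y \<in> H" "Y \<inter> S = X - {a}"
          using S unfolding shatters_def H1_def by blast
        show "\<exists>Y\<in>H. Y \<inter> insert a S = X"
        proof (cases "a \<in> X")
          case True
          then have "insert a Y \<inter> insert a S = X" using Y X by blast
          then show ?thesis using Y by blast
        next
          case False
          then have "Y \<inter> insert a S = X" using Y X by blast
          then show ?thesis using Y by blast
        qed
      qed
      then show "insert a S \<subseteq> insert a A \<and> shatters H (insert a S)" using S by auto
    qed
    have "card ?K0 + card ?K1 = card (?K0 \<union> insert a ` ?K1)"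
      using card_Un_disjoint[OF fA(1) finite_imageI[OF fA(2)] dj] card_image[OF ij] by simp
    also have "\<dots> \<le> card {S. S \<subseteq> insert a A \<and> shatters H S}"
      using s0 s1 insert.hyps by (intro card_mono) auto
    finally show ?thesis .
  qed
  ultimately show ?case by linarith
qed

text \<open>A crude polynomial bound suffices, as only its logarithm competes with a multiple of the
  sample size. The summand 1 keeps the base positive, so that all exponents can be raised to
  \<open>d\<close>.\<close>

lemma sauer_shelah:
  assumes "finite A" "H \<subseteq> Pow A" "\<And>S. S \<subseteq> A \<Longrightarrow> shatters H S \<Longrightarrow> card S < d"
  shows "card H \<le> d * (card A + 1) ^ d"
proof -
  have "card H \<le> card {S. S \<subseteq> A \<and> shatters H S}" by (rule card_le_card_shattered) fact+
  also have "\<dots> \<le> card (\<Union>k<d. {S. S \<subseteq> A \<and> card S = k})"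
    using assms by (intro card_mono) auto
  also have "\<dots> \<le> (\<Sum>k<d. card {S. S \<subseteq> A \<and> card S = k})" by (rule card_UN_le) simp
  also have "\<dots> \<le> (\<Sum>k<d. (card A + 1) ^ d)"
  proof (rule sum_mono)
    fix k assume k: "k \<in> {..<d}"
    show "card {S. S \<subseteq> A \<and> card S = k} \<le> (card A + 1) ^ d"
    proof (cases "k \<le> card A")
      case True
      have "card {S. S \<subseteq> A \<and> card S = k} = card A choose k" using assms by (simp add: n_subsets)
      also have "\<dots> \<le> card A ^ k" by (rule binomial_le_pow[OF True])
      also have "\<dots> \<le> (card A + 1) ^ k" by (rule power_mono) auto
      also have "\<dots> \<le> (card A + 1) ^ d" using k by (intro power_increasing) auto
      finally show ?thesis .
    next
      case False
      then show ?thesis using assms by (simp add: n_subsets binomial_eq_0)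
    qed
  qed
  finally show ?thesis by simp
qed

section \<open>Uniform approximation by finite samples\<close>

text \<open>A Hoeffding bound for a random sign, with \<open>l\<^sup>2\<close> in place of the sharp
  exponent \<open>u\<^sup>2 / 2\<close>; this costs only a constant factor in the sample
  size.\<close>

lemma exp_add_exp_minus_le:
  fixes u l :: real
  assumes "\<bar>u\<bar> \<le> l" "l \<le> 1"
  shows "exp u + exp (- u) \<le> 2 * exp (l\<^sup>2)"
proof -
  have *: "exp x \<le> 1 + x + x\<^sup>2" if "\<bar>x\<bar> \<le> 1" for x :: real
  proof (cases "0 \<le> x")
    case True then show ?thesis using that exp_bound by auto
  next
    case False
    define y where "y = - x"
    have y: "0 < y" "y \<le> 1" using False that by (auto simp: y_def)
    \<comment> \<open>The product equals \<open>1 + y ^ 3\<close>.\<close>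
    have "1 \<le> (1 - y + y\<^sup>2) * (1 + y)" using y by (simp add: algebra_simps power2_eq_square)
    also have "\<dots> \<le> (1 - y + y\<^sup>2) * exp y"
      using y by (intro mult_left_mono exp_ge_add_one_self) auto
    finally have "exp (- y) \<le> 1 - y + y\<^sup>2" by (simp add: exp_minus field_simps)
    then show ?thesis by (simp add: y_def)
  qed
  have "exp u + exp (- u) \<le> 2 * (1 + u\<^sup>2)" using *[of u] *[of "- u"] assms by auto
  also have "u\<^sup>2 \<le> l\<^sup>2" using assms by (metis abs_le_square_iff abs_ge_self order_trans)
  also have "1 + l\<^sup>2 \<le> exp (l\<^sup>2)" by simp
  finally show ?thesis by simp
qed

text \<open>Massart's finite class lemma. The concavity of the logarithm enters as
  \<open>ln y \<le> y / C + ln C - 1\<close>.\<close>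

lemma sum_signs_select_le:
  fixes V :: "('i \<Rightarrow> real) set" and l :: real
  assumes I: "finite I" and V: "finite V" and l: "0 < l" "l \<le> 1"
    and bd: "\<And>v i. v \<in> V \<Longrightarrow> i \<in> I \<Longrightarrow> \<bar>v i\<bar> \<le> 1"
    and w: "\<And>P. P \<subseteq> I \<Longrightarrow> w P \<in> V"
  shows "(\<Sum>P\<in>Pow I. \<bar>\<Sum>i\<in>I. if i \<in> P then w P i else - w P i\<bar>)
           \<le> 2 ^ card I * ((ln (2 * card V) + card I * l\<^sup>2) / l)"
proof -
  let ?n = "card I"
  define Z where "Z v P = (\<Sum>i\<in>I. if i \<in> P then v i else - v i)" for v :: "'i \<Rightarrow> real" and P
  \<comment> \<open>\<open>C\<close> bounds the average over the signs of the sum of all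
    \<open>exp (l * Z v P) + exp (- l * Z v P)\<close>. With the tangent of the logarithm taken at
    \<open>C\<close>, the terms \<open>y / C\<close> average to at most 1, which cancels the
    \<open>- 1\<close>.\<close>
  define C where "C = 2 * card V * exp (?n * l\<^sup>2)"
  have "w {} \<in> V" using w by simp
  then have cV: "card V > 0" using V card_gt_0_iff by blast
  then have C: "C > 0" by (simp add: C_def)
  have expZ: "(\<Sum>P\<in>Pow I. exp (s * Z v P)) \<le> 2 ^ ?n * exp (?n * l\<^sup>2)"
    if v: "v \<in> V" and s: "\<bar>s\<bar> = l" for v s
  proof -
    have "(\<Sum>P\<in>Pow I. exp (s * Z v P))
        = (\<Sum>P\<in>Pow I. (\<Prod>i\<in>P. exp (s * v i)) * (\<Prod>i\<in>I - P. exp (- (s * v i))))"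
    proof (rule sum.cong[OF refl])
      fix P assume P: "P \<in> Pow I"
      have f: "finite P" using P I finite_subset by auto
      have "Z v P = (\<Sum>i\<in>P. v i) + (\<Sum>i\<in>I - P. - v i)"
      proof -
        have "Z v P = (\<Sum>i\<in>I - P. if i \<in> P then v i else - v i) + (\<Sum>i\<in>P. if i \<in> P then v i else - v i)"
          unfolding Z_def using P I by (intro sum.subset_diff) auto
        then show ?thesis by simp
      qed
      then have "s * Z v P = (\<Sum>i\<in>P. s * v i) + (\<Sum>i\<in>I - P. - (s * v i))"
        by (simp add: distrib_left sum_distrib_left sum_negf right_diff_distrib)
      then show "exp (s * Z v P) = (\<Prod>i\<in>P. exp (s * v i)) * (\<Prod>i\<in>I - P. exp (- (s * v i)))"
        using f I by (simp only: exp_add exp_sum finite_Diff)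
    qed
    also have "\<dots> = (\<Prod>i\<in>I. exp (s * v i) + exp (- (s * v i)))"
      using I by (simp add: prod_add)
    also have "\<dots> \<le> (\<Prod>i\<in>I. 2 * exp (l\<^sup>2))"
    proof (intro prod_mono conjI exp_add_exp_minus_le)
      fix i assume "i \<in> I"
      then show "\<bar>s * v i\<bar> \<le> l" using bd[OF v] s l by (simp add: abs_mult mult_left_le)
    qed (use l in \<open>auto simp: add_nonneg_nonneg\<close>)
    also have "\<dots> = 2 ^ ?n * exp (?n * l\<^sup>2)" by (simp add: power_mult_distrib exp_of_nat_mult)
    finally show ?thesis .
  qed
  have pt: "l * \<bar>Z (w P) P\<bar> \<le> (\<Sum>v\<in>V. exp (l * Z v P) + exp (- l * Z v P)) / C + ln C - 1"
    if "P \<in> Pow I" for P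
  proof -
    have y: "ln y \<le> y / C + ln C - 1" if "y > 0" for y
    proof -
      have "ln (y / C) \<le> y / C - 1" using that C by (intro ln_le_minus_one) auto
      then show ?thesis using that C by (simp add: ln_div)
    qed
    have "l * \<bar>Z (w P) P\<bar> = ln (exp (l * \<bar>Z (w P) P\<bar>))" by simp
    also have "\<dots> \<le> exp (l * \<bar>Z (w P) P\<bar>) / C + ln C - 1" by (rule y) simp
    also have "exp (l * \<bar>Z (w P) P\<bar>) \<le> exp (l * Z (w P) P) + exp (- l * Z (w P) P)"
      by (cases "0 \<le> Z (w P) P") auto
    also have "\<dots> \<le> (\<Sum>v\<in>V. exp (l * Z v P) + exp (- l * Z v P))"
      using V w that by (intro member_le_sum) (auto simp: add_nonneg_nonneg)
    finally show ?thesis using C by (simp add: divide_right_mono)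
  qed
  have "l * (\<Sum>P\<in>Pow I. \<bar>Z (w P) P\<bar>) \<le>
      (\<Sum>P\<in>Pow I. (\<Sum>v\<in>V. exp (l * Z v P) + exp (- l * Z v P)) / C + ln C - 1)"
    unfolding sum_distrib_left by (rule sum_mono) (rule pt)
  also have "\<dots> = (\<Sum>P\<in>Pow I. \<Sum>v\<in>V. exp (l * Z v P) + exp (- l * Z v P)) / C + 2 ^ ?n * (ln C - 1)"
    using I by (simp add: sum.distrib sum_subtractf sum_divide_distrib[symmetric] card_Pow right_diff_distrib)
  also have "(\<Sum>P\<in>Pow I. \<Sum>v\<in>V. exp (l * Z v P) + exp (- l * Z v P))
      = (\<Sum>v\<in>V. (\<Sum>P\<in>Pow I. exp (l * Z v P)) + (\<Sum>P\<in>Pow I. exp (- l * Z v P)))"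
    by (subst sum.swap) (simp add: sum.distrib)
  also have "\<dots> \<le> (\<Sum>v\<in>V. 2 ^ ?n * exp (?n * l\<^sup>2) + 2 ^ ?n * exp (?n * l\<^sup>2))"
    using l by (intro sum_mono add_mono expZ) auto
  also have "\<dots> = 2 ^ ?n * C" by (simp add: C_def)
  finally have "l * (\<Sum>P\<in>Pow I. \<bar>Z (w P) P\<bar>) \<le> 2 ^ ?n * ln C"
    using C by (simp add: divide_right_mono algebra_simps)
  also have "ln C = ln (2 * card V) + ?n * l\<^sup>2"
    using cV by (simp add: C_def ln_mult)
  finally show ?thesis using l by (simp add: Z_def field_simps)
qed

text \<open>Each coordinate of a uniformly chosen tuple is uniformly distributed on
  \<open>A\<close>. Writing \<open>f (x j)\<close> as a product with trivial factors allows sum and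
  product to be exchanged.\<close>

lemma sum_PiE_component:
  fixes f :: "'a \<Rightarrow> real"
  assumes "finite I" "finite A" "j \<in> I"
  shows "(\<Sum>x\<in>(PiE I (\<lambda>_. A)). f (x j)) = card A ^ (card I - 1) * (\<Sum>a\<in>A. f a)"
proof -
  have "(\<Sum>x\<in>(PiE I (\<lambda>_. A)). f (x j))
      = (\<Sum>x\<in>(PiE I (\<lambda>_. A)). \<Prod>i\<in>I. if i = j then f (x i) else 1)"
    using assms by (intro sum.cong refl) simp
  also have "\<dots> = (\<Prod>i\<in>I. \<Sum>a\<in>A. if i = j then f a else 1)"
    using assms by (subst prod_sum_PiE) auto
  also have "\<dots> = (\<Sum>a\<in>A. f a) * (\<Prod>i\<in>I - {j}. \<Sum>a\<in>A. if i = j then f a else 1)"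
    using assms by (subst prod.remove[of I j]) auto
  also have "(\<Prod>i\<in>I - {j}. \<Sum>a\<in>A. if i = j then f a else 1) = (\<Prod>i\<in>I - {j}. real (card A))"
    by (intro prod.cong) auto
  finally show ?thesis using assms by (simp add: mult.commute)
qed

text \<open>Symmetrisation: were every sample \<open>x\<close> bad for some \<open>c x\<close> in \<open>H\<close>, comparing it
  with an independent second sample and exchanging entries of the two samples
  would contradict Massart's lemma for the traces of \<open>H\<close> on both.\<close>

lemma uniform_sample_exists:
  fixes H :: "'a set set" and \<epsilon> :: real and N d :: nat
  assumes A: "finite A" "A \<noteq> {}" and H: "H \<subseteq> Pow A"
    and vc: "\<And>S. S \<subseteq> A \<Longrightarrow> shatters H S \<Longrightarrow> card S < d"
    and eps: "0 < \<epsilon>" "\<epsilon> \<le> 1" and N: "0 < N"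
    and large: "ln (2 * (d * (2 * N + 1) ^ d)) < N * \<epsilon>\<^sup>2 / 4"
  shows "\<exists>x. (\<forall>i<N. x i \<in> A) \<and>
    (\<forall>S\<in>H. \<bar>card {i. i < N \<and> x i \<in> S} - N * (card S / card A)\<bar> \<le> N * \<epsilon>)"
proof (rule ccontr)
  assume contr: "\<not> ?thesis"
  define Q where "Q = PiE {..<N} (\<lambda>_. A)"
  have finQ: "finite Q" unfolding Q_def using A by (intro finite_PiE) auto
  have cQ: "card Q = card A ^ N" by (simp add: Q_def card_PiE)
  have cQ0: "card Q > 0" using A cQ by (simp add: card_gt_0_iff)
  have "\<exists>S\<in>H. N * \<epsilon> < \<bar>card {i. i < N \<and> x i \<in> S} - N * (card S / card A)\<bar>" if "x \<in> Q" for x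
  proof -
    have "\<forall>i<N. x i \<in> A" using that by (auto simp: Q_def)
    then show ?thesis using contr by (meson not_le)
  qed
  then obtain c where c: "\<And>x. x \<in> Q \<Longrightarrow> c x \<in> H"
    "\<And>x. x \<in> Q \<Longrightarrow> N * \<epsilon> < \<bar>card {i. i < N \<and> x i \<in> c x} - N * (card (c x) / card A)\<bar>"
    by metis
  define f where "f S x y = (\<Sum>i<N. of_bool (x i \<in> S) - (of_bool (y i \<in> S) :: real))"
    for S and x y :: "nat \<Rightarrow> 'a"
  define L where "L = (\<Sum>x\<in>Q. \<Sum>y\<in>Q. \<bar>f (c x) x y\<bar>)"
  \<comment> \<open>For fixed \<open>x\<close> the hits of the second sample \<open>y\<close> in
    \<open>c x\<close> average to \<open>N * (card (c x) / card A)\<close>. The mean of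
    \<open>f (c x) x y\<close> over \<open>y\<close> is therefore the deviation of \<open>x\<close>
    itself, and the triangle inequality bounds that deviation by the mean of the absolute
    values.\<close>
  have "card Q * (N * \<epsilon>) < (\<Sum>y\<in>Q. \<bar>f (c x) x y\<bar>)" if x: "x \<in> Q" for x
  proof -
    have sub: "c x \<subseteq> A" using c x H by auto
    have cnt: "real (card {i. i < N \<and> x i \<in> c x}) = (\<Sum>i<N. of_bool (x i \<in> c x))"
      by (simp add: of_bool_def sum.If_cases Int_def)
    have "(\<Sum>y\<in>Q. \<Sum>i<N. of_bool (y i \<in> c x) :: real) = (\<Sum>i<N. \<Sum>y\<in>Q. of_bool (y i \<in> c x))"
      by (rule sum.swap)
    also have "\<dots> = (\<Sum>i<N. real (card A ^ (N - 1) * card (c x)))"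
    proof (intro sum.cong refl)
      fix i assume "i \<in> {..<N}"
      then have "(\<Sum>y\<in>Q. of_bool (y i \<in> c x) :: real) = real (card A ^ (N - 1)) * (\<Sum>a\<in>A. of_bool (a \<in> c x))"
        unfolding Q_def using A sum_PiE_component[of "{..<N}" A i "\<lambda>a. of_bool (a \<in> c x)"] by simp
      also have "(\<Sum>a\<in>A. of_bool (a \<in> c x) :: real) = card (c x)"
        using A sub by (simp add: of_bool_def sum.If_cases Int_absorb1)
      finally show "(\<Sum>y\<in>Q. of_bool (y i \<in> c x) :: real) = real (card A ^ (N - 1) * card (c x))" by simp
    qed
    also have "\<dots> = card Q * (N * (card (c x) / card A))"
      using N A by (cases N) (simp_all add: cQ card_gt_0_iff)
    finally have s2: "(\<Sum>y\<in>Q. \<Sum>i<N. of_bool (y i \<in> c x) :: real) = card Q * (N * (card (c x) / card A))" .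
    have "(\<Sum>y\<in>Q. f (c x) x y) = card Q * (card {i. i < N \<and> x i \<in> c x} - N * (card (c x) / card A))"
      unfolding f_def sum_subtractf s2 by (simp add: cnt right_diff_distrib)
    then have "\<bar>\<Sum>y\<in>Q. f (c x) x y\<bar> = card Q * \<bar>card {i. i < N \<and> x i \<in> c x} - N * (card (c x) / card A)\<bar>"
      by (simp add: abs_mult)
    moreover have "\<bar>\<Sum>y\<in>Q. f (c x) x y\<bar> \<le> (\<Sum>y\<in>Q. \<bar>f (c x) x y\<bar>)" by (rule sum_abs)
    moreover have "card Q * (N * \<epsilon>) < card Q * \<bar>card {i. i < N \<and> x i \<in> c x} - N * (card (c x) / card A)\<bar>"
      using c(2)[OF x] cQ0 by (intro mult_strict_left_mono) auto
    ultimately show ?thesis by linarith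
  qed
  then have "(\<Sum>x\<in>Q. card Q * (N * \<epsilon>)) < L"
    unfolding L_def using finQ cQ0 by (intro sum_strict_mono) auto
  then have low: "real (card Q) * (card Q * (N * \<epsilon>)) < L" by simp
  \<comment> \<open>With this choice the two summands of \<open>b\<close> are balanced:
    \<open>N * l\<close> is \<open>N * \<epsilon> / 2\<close>, and \<open>large\<close> makes the
    logarithm divided by \<open>l\<close> smaller than the same number.\<close>
  define l where "l = \<epsilon> / 2"
  define b where "b = (ln (2 * (d * (2 * N + 1) ^ d)) + N * l\<^sup>2) / l"
  \<comment> \<open>\<open>sw P\<close> exchanges the entries with index outside \<open>P\<close>.
    It permutes \<open>Q \<times> Q\<close>, so averaging over \<open>P\<close> leaves
    \<open>L\<close> unchanged. In \<open>f\<close> it acts by signs, but the set chosen by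
    \<open>c\<close> changes with the first sample; this is why the sign lemma admits a vector
    \<open>w P\<close> depending on \<open>P\<close>.\<close>
  define sw where "sw P z = ((\<lambda>i. if i \<in> P then fst z i else snd z i), (\<lambda>i. if i \<in> P then snd z i else fst z i))"
    for P :: "nat set" and z :: "(nat \<Rightarrow> 'a) \<times> (nat \<Rightarrow> 'a)"
  define g where "g z = \<bar>f (c (fst z)) (fst z) (snd z)\<bar>" for z
  have LL: "L = (\<Sum>z\<in>Q \<times> Q. g z)"
    unfolding L_def g_def by (simp add: sum.cartesian_product case_prod_unfold)
  have mixQ: "(\<lambda>i. if i \<in> P then x i else y i) \<in> Q" if "x \<in> Q" "y \<in> Q" for P x y
    using that unfolding Q_def PiE_def Pi_def extensional_def by simp
  have swQ: "sw P z \<in> Q \<times> Q" if "z \<in> Q \<times> Q" for P z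
    using that mixQ[of "fst z" "snd z"] mixQ[of "snd z" "fst z"] by (simp add: sw_def mem_Times_iff)
  have swsw: "sw P (sw P z) = z" for P z by (cases z) (auto simp: sw_def)
  have Lsw: "(\<Sum>z\<in>Q \<times> Q. g (sw P z)) = L" for P
    unfolding LL by (rule sum.reindex_bij_witness[of _ "sw P" "sw P"]) (use swQ swsw in auto)
  have bound: "(\<Sum>P\<in>Pow {..<N}. g (sw P z)) \<le> 2 ^ N * b" if z: "z \<in> Q \<times> Q" for z
  proof -
    define v where "v S i = (if i < N then of_bool (fst z i \<in> S) - of_bool (snd z i \<in> S) else 0 :: real)" for S i
    define V where "V = v ` H"
    \<comment> \<open>\<open>v S\<close> depends on \<open>S \<inter> W\<close> only, and
      \<open>W\<close> has at most \<open>2 * N\<close> points; this makes the bound independent of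
      \<open>card A\<close>.\<close>
    define W where "W = fst z ` {..<N} \<union> snd z ` {..<N}"
    have finH: "finite H" using H A by (meson finite_Pow_iff finite_subset)
    have "fst z \<in> Q" "snd z \<in> Q" using z by (auto simp: mem_Times_iff)
    then have W: "W \<subseteq> A" "finite W" unfolding W_def Q_def by (blast dest: PiE_mem, simp)
    have cW: "card W \<le> 2 * N"
    proof -
      have "card (fst z ` {..<N}) \<le> N" "card (snd z ` {..<N}) \<le> N"
        using card_image_le[of "{..<N}"] by (metis card_lessThan finite_lessThan)+
      then show ?thesis
        using card_Un_le[of "fst z ` {..<N}" "snd z ` {..<N}"] unfolding W_def by linarith
    qed
    have "V \<subseteq> v ` ((\<lambda>S. S \<inter> W) ` H)"
    proof -
      have "v S = v (S \<inter> W)" for S by (auto simp: v_def W_def)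
      then show ?thesis unfolding V_def by blast
    qed
    then have "card V \<le> card ((\<lambda>S. S \<inter> W) ` H)" using finH by (meson finite_imageI surj_card_le)
    also have "\<dots> \<le> d * (card W + 1) ^ d"
    proof (rule sauer_shelah[OF W(2)])
      fix S assume S: "S \<subseteq> W" "shatters ((\<lambda>S. S \<inter> W) ` H) S"
      have "shatters H S" unfolding shatters_def
      proof (intro allI impI)
        fix X assume "X \<subseteq> S"
        then obtain Y where "Y \<in> H" "Y \<inter> W \<inter> S = X" using S(2) unfolding shatters_def by blast
        then show "\<exists>Y\<in>H. Y \<inter> S = X" using S(1) by blast
      qed
      then show "card S < d" using vc S W by blast
    qed auto
    also have "\<dots> \<le> d * (2 * N + 1) ^ d" using cW by (intro mult_left_mono power_mono) auto
    finally have cV: "card V \<le> d * (2 * N + 1) ^ d" .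
    have VH: "v (c (fst (sw P z))) \<in> V" for P using c(1) swQ[OF z, of P] by (auto simp: V_def mem_Times_iff)
    have finV: "finite V" using finH by (simp add: V_def)
    have V0: "card V > 0" using VH finV by (auto simp: card_gt_0_iff)
    have bdv: "\<bar>v S i\<bar> \<le> 1" for S i by (simp add: v_def of_bool_def)
    have "(\<Sum>P\<in>Pow {..<N}. g (sw P z)) = (\<Sum>P\<in>Pow {..<N}. \<bar>\<Sum>i\<in>{..<N}. if i \<in> P then v (c (fst (sw P z))) i else - v (c (fst (sw P z))) i\<bar>)"
      unfolding g_def f_def by (intro sum.cong refl arg_cong[of _ _ abs]) (auto simp: sw_def v_def)
    also have "\<dots> \<le> 2 ^ card {..<N} * ((ln (2 * card V) + card {..<N} * l\<^sup>2) / l)"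
      by (rule sum_signs_select_le) (use eps finV VH bdv in \<open>auto simp: l_def V_def\<close>)
    also have "\<dots> \<le> 2 ^ N * b"
    proof -
      have "real (2 * card V) \<le> real (2 * (d * (2 * N + 1) ^ d))" using cV by (intro of_nat_mono) simp
      then have "ln (real (2 * card V)) \<le> ln (real (2 * (d * (2 * N + 1) ^ d)))" using V0 by (subst ln_le_cancel_iff) linarith+
      then show ?thesis unfolding b_def using eps by (simp add: l_def divide_right_mono)
    qed
    finally show ?thesis .
  qed
  have "2 ^ N * L = (\<Sum>P\<in>Pow {..<N}. \<Sum>z\<in>Q \<times> Q. g (sw P z))" by (simp add: Lsw card_Pow)
  also have "\<dots> = (\<Sum>z\<in>Q \<times> Q. \<Sum>P\<in>Pow {..<N}. g (sw P z))" by (rule sum.swap)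
  also have "\<dots> \<le> (\<Sum>z\<in>Q \<times> Q. 2 ^ N * b)" by (rule sum_mono) (rule bound)
  also have "\<dots> = 2 ^ N * (real (card Q) * (card Q * b))" by (simp add: card_cartesian_product)
  finally have "L \<le> real (card Q) * (card Q * b)" by simp
  also have "b \<le> N * \<epsilon>"
    using large eps by (simp add: b_def l_def field_simps power2_eq_square)
  finally show False using low cQ0 by (simp add: mult_left_mono)
qed

text \<open>The logarithm of a polynomial in \<open>N\<close> grows more slowly than
  \<open>N\<close>. The size depends on \<open>d\<close> and \<epsilon> alone, so that one formula
  can serve all the finite groups.\<close>

lemma uniform_sample_size_exists:
  fixes \<epsilon> :: real and d :: nat
  assumes "0 < \<epsilon>"
  shows "\<exists>N::nat>0. ln (real (2 * (d * (2 * N + 1) ^ d))) < real N * \<epsilon>\<^sup>2 / 4"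
proof (cases "d = 0")
  \<comment> \<open>For \<open>d = 0\<close> the left side is \<open>ln 0\<close>, which is
    0.\<close>
  case True
  then show ?thesis using assms by (intro exI[of _ 1]) simp
next
  case False
  have "((\<lambda>N. (ln (2 * real d) + real d * ln (2 * real N + 1)) / real N) \<longlongrightarrow> 0) at_top"
    by real_asymp
  then have "eventually (\<lambda>N. (ln (2 * real d) + real d * ln (2 * real N + 1)) / real N < \<epsilon>\<^sup>2 / 4) at_top"
    by (rule order_tendstoD) (use assms in simp)
  then have "eventually (\<lambda>N. N > 0 \<and> (ln (2 * real d) + real d * ln (2 * real N + 1)) / real N < \<epsilon>\<^sup>2 / 4) at_top"
    using eventually_gt_at_top[of 0] by eventually_elim auto
  then obtain N where N: "N > 0" "(ln (2 * real d) + real d * ln (2 * real N + 1)) / real N < \<epsilon>\<^sup>2 / 4"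
    by (auto simp: eventually_at_top_linorder)
  have "ln (real (2 * (d * (2 * N + 1) ^ d))) = ln ((2 * real d) * (2 * real N + 1) ^ d)" by (simp add: algebra_simps)
  also have "\<dots> = ln (2 * real d) + real d * ln (2 * real N + 1)"
    using False by (subst ln_mult) (auto simp: ln_realpow)
  also have "\<dots> < real N * \<epsilon>\<^sup>2 / 4" using N by (simp add: field_simps)
  finally show ?thesis using N by blast
qed

section \<open>Formulas of the two-sorted language\<close>

text \<open>Only variables of the group sort are collected, as \<open>psat_cong\<close> and the
  transfer keep the environment of sort I fixed.\<close>

primrec gfv_i :: "('f, 'r) itrm \<Rightarrow> nat set" where
  "gfv_i (IVar n) = {}"
| "gfv_i (Dist s t) = gfv_i s \<union> gfv_i t"
| "gfv_i (Mu \<phi> n ts) = (\<Union>t\<in>set ts. fv_trm t)"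

primrec gfv :: "('f, 'r) pfm \<Rightarrow> nat set" where
  "gfv (PEq s t) = fv_trm s \<union> fv_trm t"
| "gfv (PRel r ts) = (\<Union>t\<in>set ts. fv_trm t)"
| "gfv (IEq s t) = gfv_i s \<union> gfv_i t"
| "gfv (ILess s t) = gfv_i s \<union> gfv_i t"
| "gfv (PNeg \<psi>) = gfv \<psi>"
| "gfv (PConj \<psi> \<chi>) = gfv \<psi> \<union> gfv \<chi>"
| "gfv (PExG n \<psi>) = gfv \<psi> - {n}"
| "gfv (PExI n \<psi>) = gfv \<psi>"

lemma evt_cong: "(\<And>n. n \<in> fv_trm t \<Longrightarrow> e n = e' n) \<Longrightarrow> evt F e t = evt F e' t"
proof (induction t)
  case (Fn f ts)
  then have "map (evt F e) ts = map (evt F e') ts" by (auto intro!: map_cong)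
  then show ?case by (simp only: evt.simps)
qed simp

lemma map_evt_cong:
  assumes "\<And>n. n \<in> (\<Union>t\<in>set ts. fv_trm t) \<Longrightarrow> e n = e' n"
  shows "map (evt F e) ts = map (evt F e') ts"
proof (rule map_cong[OF refl])
  fix t assume "t \<in> set ts"
  then show "evt F e t = evt F e' t" by (intro evt_cong assms) blast
qed

lemma satL_cong: "(\<And>n. n \<in> fv_fm \<phi> \<Longrightarrow> e n = e' n) \<Longrightarrow> satL D F R e \<phi> = satL D F R e' \<phi>"
proof (induction \<phi> arbitrary: e e')
  case (Eq s t)
  then show ?case using evt_cong[of s e e' F] evt_cong[of t e e' F] by simp
next
  case (Rel r ts)
  have "map (evt F e) ts = map (evt F e') ts" by (rule map_evt_cong) (use Rel in auto)
  then show ?case by (simp only: satL.simps)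
next
  case (Neg \<phi>)
  have "satL D F R e \<phi> = satL D F R e' \<phi>" by (rule Neg.IH) (simp add: Neg.prems)
  then show ?case by simp
next
  case (Conj \<phi> \<psi>)
  have "satL D F R e \<phi> = satL D F R e' \<phi>" by (rule Conj.IH(1)) (simp add: Conj.prems)
  moreover have "satL D F R e \<psi> = satL D F R e' \<psi>" by (rule Conj.IH(2)) (simp add: Conj.prems)
  ultimately show ?case by simp
next
  case (Ex n \<phi>)
  have "satL D F R (e(n := a)) \<phi> = satL D F R (e'(n := a)) \<phi>" for a
    by (rule Ex.IH) (use Ex.prems in auto)
  then show ?case by simp
qed

lemma evi_cong: "(\<And>n. n \<in> gfv_i s \<Longrightarrow> e n = e' n) \<Longrightarrow> evi S e ei s = evi S e' ei s"
proof (induction s)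
  case (Mu \<phi> n ts)
  have "map (evt (fnG S) e) ts = map (evt (fnG S) e') ts" by (rule map_evt_cong) (use Mu in auto)
  then show ?case by (simp only: evi.simps)
qed simp_all

lemma psat_cong: "(\<And>n. n \<in> gfv \<psi> \<Longrightarrow> e n = e' n) \<Longrightarrow> psat S e ei \<psi> = psat S e' ei \<psi>"
proof (induction \<psi> arbitrary: e e' ei)
  case (PEq s t)
  then show ?case using evt_cong[of s e e' "fnG S"] evt_cong[of t e e' "fnG S"] by simp
next
  case (PRel r ts)
  have "map (evt (fnG S) e) ts = map (evt (fnG S) e') ts" by (rule map_evt_cong) (use PRel in auto)
  then show ?case by (simp only: psat.simps)
next
  case (IEq s t)
  then show ?case using evi_cong[of s e e' S ei] evi_cong[of t e e' S ei] by simp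
next
  case (ILess s t)
  then show ?case using evi_cong[of s e e' S ei] evi_cong[of t e e' S ei] by simp
next
  case (PNeg \<psi>)
  have "psat S e ei \<psi> = psat S e' ei \<psi>" by (rule PNeg.IH) (simp add: PNeg.prems)
  then show ?case by simp
next
  case (PConj \<psi> \<chi>)
  have "psat S e ei \<psi> = psat S e' ei \<psi>" by (rule PConj.IH(1)) (simp add: PConj.prems)
  moreover have "psat S e ei \<chi> = psat S e' ei \<chi>" by (rule PConj.IH(2)) (simp add: PConj.prems)
  ultimately
  show ?case by simp
next
  case (PExG n \<psi>)
  have "psat S (e(n := a)) ei \<psi> = psat S (e'(n := a)) ei \<psi>" for a
    by (rule PExG.IH) (use PExG.prems in auto)
  then show ?case by simp
next
  case (PExI n \<psi>)
  have "psat S e (ei(n := a)) \<psi> = psat S e' (ei(n := a)) \<psi>" for a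
    by (rule PExI.IH) (use PExI.prems in auto)
  then show ?case by simp
qed

section \<open>Building blocks for sentences to be transferred\<close>

primrec emb :: "('f, 'r) fm \<Rightarrow> ('f, 'r) pfm" where
  "emb (Eq s t) = PEq s t"
| "emb (Rel r ts) = PRel r ts"
| "emb (Neg \<phi>) = PNeg (emb \<phi>)"
| "emb (Conj \<phi> \<psi>) = PConj (emb \<phi>) (emb \<psi>)"
| "emb (Ex n \<phi>) = PExG n (emb \<phi>)"

lemma psat_emb: "psat S e ei (emb \<phi>) = satL (domG S) (fnG S) (relG S) e \<phi>"
  by (induction \<phi> arbitrary: e) simp_all

lemma wf_pfm_emb: "wf_pfm ar rar (emb \<phi>) = wf_fm ar rar \<phi>"
  by (induction \<phi>) simp_all

lemma gfv_emb: "gfv (emb \<phi>) = fv_fm \<phi>"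
  by (induction \<phi>) simp_all

definition PExs :: "nat list \<Rightarrow> ('f, 'r) pfm \<Rightarrow> ('f, 'r) pfm" where
  "PExs ns \<psi> = foldr PExG ns \<psi>"

lemma psat_PExs:
  "psat S e ei (PExs ns \<psi>) \<longleftrightarrow>
     (\<exists>f. (\<forall>m\<in>set ns. f m \<in> domG S) \<and> psat S (override_on e f (set ns)) ei \<psi>)"
proof (induction ns arbitrary: e)
  case Nil
  then show ?case by (simp add: PExs_def)
next
  case (Cons n ns)
  have "psat S e ei (PExs (n # ns) \<psi>) \<longleftrightarrow> (\<exists>a\<in>domG S. psat S (e(n := a)) ei (PExs ns \<psi>))"
    by (simp add: PExs_def)
  also have "\<dots> \<longleftrightarrow> (\<exists>a\<in>domG S. \<exists>f. (\<forall>m\<in>set ns. f m \<in> domG S) \<and>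
      psat S (override_on (e(n := a)) f (set ns)) ei \<psi>)"
    by (simp only: Cons.IH)
  also have "\<dots> \<longleftrightarrow> (\<exists>f. (\<forall>m\<in>set (n # ns). f m \<in> domG S) \<and>
      psat S (override_on e f (set (n # ns))) ei \<psi>)" (is "?l \<longleftrightarrow> ?r")
  proof
    assume ?l
    then obtain a f where f: "a \<in> domG S" "\<forall>m\<in>set ns. f m \<in> domG S"
      "psat S (override_on (e(n := a)) f (set ns)) ei \<psi>" by blast
    \<comment> \<open>If \<open>n\<close> occurs again in \<open>ns\<close>, the inner quantifier
      wins, so \<open>f\<close> takes precedence over \<open>a\<close>.\<close>
    define f' where "f' m = (if m \<in> set ns then f m else a)" for m
    have "override_on e f' (set (n # ns)) = override_on (e(n := a)) f (set ns)"
      by (auto simp: override_on_def f'_def)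
    moreover have "\<forall>m\<in>set (n # ns). f' m \<in> domG S" using f by (auto simp: f'_def)
    ultimately show ?r using f by metis
  next
    assume ?r
    then obtain f where f: "\<forall>m\<in>set (n # ns). f m \<in> domG S"
      "psat S (override_on e f (set (n # ns))) ei \<psi>" by blast
    have "override_on e f (set (n # ns)) = override_on (e(n := f n)) f (set ns)"
      by (auto simp: override_on_def)
    then have "psat S (override_on (e(n := f n)) f (set ns)) ei \<psi>" using f by simp
    moreover have "f n \<in> domG S" "\<forall>m\<in>set ns. f m \<in> domG S" using f by auto
    ultimately show ?l by blast
  qed
  finally show ?case .
qed

lemma wf_pfm_PExs: "wf_pfm ar rar (PExs ns \<psi>) = wf_pfm ar rar \<psi>"
  by (induction ns) (simp_all add: PExs_def)

lemma gfv_PExs: "gfv (PExs ns \<psi>) = gfv \<psi> - set ns"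
  by (induction ns) (auto simp: PExs_def)

text \<open>There is no formula for truth, so \<open>Var 0 = Var 0\<close> ends the conjunction;
  hence the \<open>insert 0\<close> in \<open>gfv_PConjs\<close>.\<close>

definition PConjs :: "('f, 'r) pfm list \<Rightarrow> ('f, 'r) pfm" where
  "PConjs \<psi>s = foldr PConj \<psi>s (PEq (Var 0) (Var 0))"

lemma psat_PConjs: "psat S e ei (PConjs \<psi>s) \<longleftrightarrow> (\<forall>\<psi>\<in>set \<psi>s. psat S e ei \<psi>)"
  by (induction \<psi>s) (simp_all add: PConjs_def)

lemma wf_pfm_PConjs: "wf_pfm ar rar (PConjs \<psi>s) \<longleftrightarrow> (\<forall>\<psi>\<in>set \<psi>s. wf_pfm ar rar \<psi>)"
  by (induction \<psi>s) (simp_all add: PConjs_def)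

lemma gfv_PConjs: "gfv (PConjs \<psi>s) = insert 0 (\<Union>\<psi>\<in>set \<psi>s. gfv \<psi>)"
  by (induction \<psi>s) (auto simp: PConjs_def)

text \<open>The sign is a truth value of the metalogic: it may depend on membership in an index set,
  or on the side of a threshold on which the density lies in G.\<close>

definition PLit :: "bool \<Rightarrow> ('f, 'r) pfm \<Rightarrow> ('f, 'r) pfm" where
  "PLit b \<psi> = (if b then \<psi> else PNeg \<psi>)"

lemma PLit_simps:
  "psat S e ei (PLit b \<psi>) \<longleftrightarrow> (b \<longleftrightarrow> psat S e ei \<psi>)"
  "wf_pfm ar rar (PLit b \<psi>) = wf_pfm ar rar \<psi>"
  "gfv (PLit b \<psi>) = gfv \<psi>"
  by (simp_all add: PLit_def)

section \<open>The theorem of Los and transfer to elementary extensions\<close>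

lemma fin_plus_simps [simp]:
  "domG (fin_plus D F R) = D" "domI (fin_plus D F R) = {0..1}" "fnG (fin_plus D F R) = F"
  "relG (fin_plus D F R) = R" "lessI (fin_plus D F R) = (<)"
  "dI (fin_plus D F R) = (\<lambda>s t. \<bar>s - t\<bar>)" "muI (fin_plus D F R) = fin_mu D F R"
  by (simp_all add: fin_plus_def)

lemma divide_le_one_nonneg: "x \<le> y \<Longrightarrow> 0 \<le> y \<Longrightarrow> x / y \<le> (1 :: real)"
  by (cases "y = 0") (simp_all add: divide_le_eq_1)

lemma fin_mu_bounds:
  assumes "finite D"
  shows "0 \<le> fin_mu D F R \<phi> n bs" "fin_mu D F R \<phi> n bs \<le> 1"
proof -
  let ?T = "{as. length as = n \<and> set as \<subseteq> D \<and> satL D F R (fenv D n as bs) \<phi>}"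
  have "card ?T \<le> card {as. set as \<subseteq> D \<and> length as = n}"
    using assms by (intro card_mono finite_lists_length_eq) auto
  also have "\<dots> = card D ^ n" using assms by (rule card_lists_length_eq)
  finally have "real (card ?T) \<le> real (card D ^ n)" by (rule of_nat_mono)
  then show "fin_mu D F R \<phi> n bs \<le> 1" unfolding fin_mu_def
    by (intro divide_le_one_nonneg) simp_all
qed (simp add: fin_mu_def)

section \<open>Almost-everywhere reasoning modulo an ultrafilter\<close>

context
  fixes U :: "'i set set"
  assumes U: "ultrafilter_on U"
begin

lemma ultra_mono: "{i. P i} \<in> U \<Longrightarrow> (\<And>i. P i \<Longrightarrow> Q i) \<Longrightarrow> {i. Q i} \<in> U"
  using U unfolding ultrafilter_on_def by (metis (mono_tags) Collect_mono)

lemma ultra_UNIV: "UNIV \<in> U"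
  using U by (simp add: ultrafilter_on_def)

lemma ultra_conj: "{i. P i \<and> Q i} \<in> U \<longleftrightarrow> {i. P i} \<in> U \<and> {i. Q i} \<in> U"
proof
  show "{i. P i \<and> Q i} \<in> U \<Longrightarrow> {i. P i} \<in> U \<and> {i. Q i} \<in> U" by (blast intro: ultra_mono)
  assume "{i. P i} \<in> U \<and> {i. Q i} \<in> U"
  then have "{i. P i} \<inter> {i. Q i} \<in> U" using U unfolding ultrafilter_on_def by blast
  then show "{i. P i \<and> Q i} \<in> U" by (simp add: Collect_conj_eq)
qed

lemma ultra_mono2:
  "{i. P i} \<in> U \<Longrightarrow> {i. Q i} \<in> U \<Longrightarrow> (\<And>i. P i \<Longrightarrow> Q i \<Longrightarrow> T i) \<Longrightarrow> {i. T i} \<in> U"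
  by (rule ultra_mono[of "\<lambda>i. P i \<and> Q i"]) (simp_all add: ultra_conj)

lemma ultra_not: "{i. \<not> P i} \<in> U \<longleftrightarrow> {i. P i} \<notin> U"
proof
  assume a: "{i. \<not> P i} \<in> U"
  show "{i. P i} \<notin> U"
  proof
    assume "{i. P i} \<in> U"
    then have "{i. False} \<in> U" using a by (rule ultra_mono2) simp
    then show False using U unfolding ultrafilter_on_def by simp
  qed
next
  assume "{i. P i} \<notin> U"
  then have "- {i. P i} \<in> U" using U unfolding ultrafilter_on_def by blast
  then show "{i. \<not> P i} \<in> U" by (simp add: Collect_neg_eq)
qed

lemma ultra_ball: "finite T \<Longrightarrow> (\<And>t. t \<in> T \<Longrightarrow> {i. P t i} \<in> U) \<Longrightarrow> {i. \<forall>t\<in>T. P t i} \<in> U"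
  by (induction T rule: finite_induct) (auto simp: ultra_conj ultra_UNIV)

lemma ultra_cong: "{i. P i = Q i} \<in> U \<Longrightarrow> {i. P i} \<in> U \<longleftrightarrow> {i. Q i} \<in> U"
  by (rule iffI; erule (1) ultra_mono2) simp_all

lemma rep_ucls:
  assumes "f \<in> S"
  shows "rep (ucls U S f) \<in> S" "{i. rep (ucls U S f) i = f i} \<in> U"
proof -
  have "f \<in> ucls U S f" using assms by (simp add: ucls_def ultra_UNIV)
  then have "rep (ucls U S f) \<in> ucls U S f" unfolding rep_def some_in_eq by blast
  then show "rep (ucls U S f) \<in> S" "{i. rep (ucls U S f) i = f i} \<in> U"
    by (auto simp: ucls_def eq_commute)
qed

lemma ucls_eq_iff:
  assumes "f \<in> S" "g \<in> S"
  shows "ucls U S f = ucls U S g \<longleftrightarrow> {i. f i = g i} \<in> U"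
proof
  assume "ucls U S f = ucls U S g"
  moreover have "g \<in> ucls U S g" using assms by (simp add: ucls_def ultra_UNIV)
  ultimately have "g \<in> ucls U S f" by simp
  then show "{i. f i = g i} \<in> U" by (simp add: ucls_def)
next
  assume fg: "{i. f i = g i} \<in> U"
  have "{i. f i = h i} \<in> U \<longleftrightarrow> {i. g i = h i} \<in> U" for h
    by (rule ultra_cong) (rule ultra_mono[OF fg], simp)
  then show "ucls U S f = ucls U S g" by (simp add: ucls_def)
qed

lemma rep_in: "c \<in> ucls U S ` S \<Longrightarrow> rep c \<in> S"
  by (auto simp: rep_ucls)

lemma eq_iff_rep:
  assumes "c \<in> ucls U S ` S" "c' \<in> ucls U S ` S"
  shows "c = c' \<longleftrightarrow> {i. rep c i = rep c' i} \<in> U"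
proof -
  have "ucls U S (rep c) = c" if "c \<in> ucls U S ` S" for c
  proof -
    from that obtain f where f: "c = ucls U S f" "f \<in> S" ..
    then show ?thesis using rep_ucls[OF f(2)] by (simp add: ucls_eq_iff)
  qed
  then show ?thesis using assms by (metis ucls_eq_iff rep_in)
qed

section \<open>The theorem of Los for terms and formulas\<close>

context
  fixes D :: "'i \<Rightarrow> 'a set" and F :: "'i \<Rightarrow> 'f \<Rightarrow> 'a list \<Rightarrow> 'a" and R :: "'i \<Rightarrow> 'r \<Rightarrow> 'a list \<Rightarrow> bool"
    and ar :: "'f \<Rightarrow> nat" and rar :: "'r \<Rightarrow> nat"
  assumes fin: "\<And>i. finite (D i)" and ok: "\<And>i. lstruct_ok ar (D i) (F i)"
begin

abbreviation (input) "UP \<equiv> ultraprod D F R U"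
abbreviation (input) "FP i \<equiv> fin_plus (D i) (F i) (R i)"

text \<open>\<open>ultraprod\<close> evaluates symbols at chosen representatives, and the value is
  again a class with a representative of its own. Hence the coordinatewise identity can be expected
  only on a set in \<open>U\<close>.\<close>

lemma los_trm:
  assumes "wf_trm ar t" "range e \<subseteq> domG UP"
  shows "evt (fnG UP) e t \<in> domG UP \<and>
    {i. rep (evt (fnG UP) e t) i = evt (F i) (\<lambda>n. rep (e n) i) t} \<in> U"
  using assms(1)
proof (induction t)
  case (Var n)
  then show ?case using assms(2) by (auto simp: ultra_UNIV)
next
  case (Fn f ts)
  let ?cs = "map (evt (fnG UP) e) ts"
  define g where "g = (\<lambda>i. F i f (map (\<lambda>c. rep c i) ?cs))"
  have v: "evt (fnG UP) e (Fn f ts) = ucls U (Dfun D) g"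
    by (simp add: ultraprod_def g_def)
  have cs: "rep (evt (fnG UP) e t) i \<in> D i" if "t \<in> set ts" for t i
    using Fn that rep_in[of _ "Dfun D"] by (fastforce simp: ultraprod_def Dfun_def)
  have g: "g \<in> Dfun D"
    unfolding g_def Dfun_def
  proof (clarify)
    fix i
    have cl: "length as = ar f \<Longrightarrow> set as \<subseteq> D i \<Longrightarrow> F i f as \<in> D i" for as
      using ok[of i] unfolding lstruct_ok_def by blast
    show "F i f (map (\<lambda>c. rep c i) ?cs) \<in> D i"
      by (rule cl) (use Fn.prems cs in auto)
  qed
  have "{i. \<forall>t\<in>set ts. rep (evt (fnG UP) e t) i = evt (F i) (\<lambda>n. rep (e n) i) t} \<in> U"
    by (rule ultra_ball) (use Fn in auto)
  then have "{i. g i = evt (F i) (\<lambda>n. rep (e n) i) (Fn f ts)} \<in> U"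
    by (rule ultra_mono) (auto simp: g_def intro!: arg_cong[of _ _ "F _ f"])
  with rep_ucls(2)[OF g] have "{i. rep (ucls U (Dfun D) g) i = evt (F i) (\<lambda>n. rep (e n) i) (Fn f ts)} \<in> U"
    by (rule ultra_mono2) simp
  then show ?case unfolding v using g by (simp add: ultraprod_def)
qed

lemma los_trms:
  assumes "\<forall>t\<in>set ts. wf_trm ar t" "range e \<subseteq> domG UP"
  shows "{i. map (\<lambda>c. rep c i) (map (evt (fnG UP) e) ts) = map (evt (F i) (\<lambda>n. rep (e n) i)) ts} \<in> U"
proof -
  have "{i. \<forall>t\<in>set ts. rep (evt (fnG UP) e t) i = evt (F i) (\<lambda>n. rep (e n) i) t} \<in> U"
    by (rule ultra_ball) (use assms los_trm in auto)
  then show ?thesis by (rule ultra_mono) simp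
qed

lemma los_itrm:
  assumes "wf_itrm ar rar s" "range e \<subseteq> domG UP" "range ei \<subseteq> domI UP"
  shows "evi UP e ei s \<in> domI UP \<and>
    {i. rep (evi UP e ei s) i = evi (FP i) (\<lambda>n. rep (e n) i) (\<lambda>n. rep (ei n) i) s} \<in> U"
proof -
  have *: "ucls U Ifun g \<in> domI UP \<and> {i. rep (ucls U Ifun g) i = h i} \<in> U"
    if "g \<in> Ifun" "{i. g i = h i} \<in> U" for g h
  proof -
    have "{i. rep (ucls U Ifun g) i = h i} \<in> U"
      by (rule ultra_mono2[OF rep_ucls(2)[OF that(1)] that(2)]) simp
    then show ?thesis using that by (simp add: ultraprod_def)
  qed
  show ?thesis using assms(1)
  proof (induction s)
    case (IVar n)
    then show ?case using assms(3) by (auto simp: ultra_UNIV)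
  next
    case (Dist s t)
    let ?g = "\<lambda>i. \<bar>rep (evi UP e ei s) i - rep (evi UP e ei t) i\<bar>"
    have eq: "evi UP e ei (Dist s t) = ucls U Ifun ?g" by (simp add: ultraprod_def)
    have g: "?g \<in> Ifun"
    proof -
      have "rep (evi UP e ei s) \<in> Ifun" "rep (evi UP e ei t) \<in> Ifun"
        using Dist by (auto simp: ultraprod_def intro: rep_in)
      then have "0 \<le> rep (evi UP e ei s) i \<and> rep (evi UP e ei s) i \<le> 1"
        "0 \<le> rep (evi UP e ei t) i \<and> rep (evi UP e ei t) i \<le> 1" for i
        by (auto simp: Ifun_def)
      then have "\<bar>rep (evi UP e ei s) i - rep (evi UP e ei t) i\<bar> \<le> 1" for i
        by (smt (verit))
      then show ?thesis by (simp add: Ifun_def)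
    qed
    have "{i. ?g i = evi (FP i) (\<lambda>n. rep (e n) i) (\<lambda>n. rep (ei n) i) (Dist s t)} \<in> U"
    proof (rule ultra_mono)
      show "{i. rep (evi UP e ei s) i = evi (FP i) (\<lambda>n. rep (e n) i) (\<lambda>n. rep (ei n) i) s \<and>
          rep (evi UP e ei t) i = evi (FP i) (\<lambda>n. rep (e n) i) (\<lambda>n. rep (ei n) i) t} \<in> U"
        using Dist by (simp add: ultra_conj)
    qed simp
    then show ?case unfolding eq by (rule *[OF g])
  next
    case (Mu \<phi> n ts)
    let ?g = "\<lambda>i. fin_mu (D i) (F i) (R i) \<phi> n (map (\<lambda>c. rep c i) (map (evt (fnG UP) e) ts))"
    have eq: "evi UP e ei (Mu \<phi> n ts) = ucls U Ifun ?g" by (simp add: ultraprod_def)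
    have g: "?g \<in> Ifun"
      by (simp add: Ifun_def fin_mu_bounds fin)
    have "{i. ?g i = evi (FP i) (\<lambda>n. rep (e n) i) (\<lambda>n. rep (ei n) i) (Mu \<phi> n ts)} \<in> U"
    proof (rule ultra_mono[OF los_trms[OF _ assms(2)]])
      show "\<forall>t\<in>set ts. wf_trm ar t" using Mu by simp
    qed (simp only: evi.simps fin_plus_simps)
    then show ?case unfolding eq by (rule *[OF g])
  qed
qed

text \<open>Negation is the case that uses the maximality of \<open>U\<close>. In the quantifier
  cases, witnesses chosen index by index form a function whose class is the witness in the
  ultraproduct.\<close>

lemma los:
  assumes "wf_pfm ar rar \<psi>" "range e \<subseteq> domG UP" "range ei \<subseteq> domI UP"
  shows "psat UP e ei \<psi> \<longleftrightarrow> {i. psat (FP i) (\<lambda>n. rep (e n) i) (\<lambda>n. rep (ei n) i) \<psi>} \<in> U"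
  using assms
proof (induction \<psi> arbitrary: e ei)
  case (PEq s t)
  have "{i. rep (evt (fnG UP) e s) i = evt (F i) (\<lambda>n. rep (e n) i) s \<and>
      rep (evt (fnG UP) e t) i = evt (F i) (\<lambda>n. rep (e n) i) t} \<in> U"
    using PEq los_trm by (simp add: ultra_conj)
  then have "{i. (rep (evt (fnG UP) e s) i = rep (evt (fnG UP) e t) i) =
      (evt (F i) (\<lambda>n. rep (e n) i) s = evt (F i) (\<lambda>n. rep (e n) i) t)} \<in> U"
    by (rule ultra_mono) simp
  note * = ultra_cong[OF this]
  have dom: "domG UP = ucls U (Dfun D) ` Dfun D" by (simp add: ultraprod_def)
  have "evt (fnG UP) e s \<in> domG UP" "evt (fnG UP) e t \<in> domG UP"
    using PEq los_trm by auto
  note ** = eq_iff_rep[OF this[unfolded dom]]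
  show ?case unfolding psat.simps ** * fin_plus_simps ..
next
  case (PRel r ts)
  have "{i. R i r (map (\<lambda>c. rep c i) (map (evt (fnG UP) e) ts)) = R i r (map (evt (F i) (\<lambda>n. rep (e n) i)) ts)} \<in> U"
  proof (rule ultra_mono[OF los_trms[OF _ PRel.prems(2)]])
    show "\<forall>t\<in>set ts. wf_trm ar t" using PRel.prems by simp
  qed (simp only:)
  note * = ultra_cong[OF this]
  have **: "relG UP r (map (evt (fnG UP) e) ts) \<longleftrightarrow> {i. R i r (map (\<lambda>c. rep c i) (map (evt (fnG UP) e) ts))} \<in> U"
    by (simp add: ultraprod_def)
  show ?case unfolding psat.simps ** * fin_plus_simps ..
next
  case (IEq s t)
  have "{i. rep (evi UP e ei s) i = evi (FP i) (\<lambda>n. rep (e n) i) (\<lambda>n. rep (ei n) i) s \<and>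
      rep (evi UP e ei t) i = evi (FP i) (\<lambda>n. rep (e n) i) (\<lambda>n. rep (ei n) i) t} \<in> U"
    using IEq los_itrm by (simp add: ultra_conj)
  then have "{i. (rep (evi UP e ei s) i = rep (evi UP e ei t) i) =
      (evi (FP i) (\<lambda>n. rep (e n) i) (\<lambda>n. rep (ei n) i) s = evi (FP i) (\<lambda>n. rep (e n) i) (\<lambda>n. rep (ei n) i) t)} \<in> U"
    by (rule ultra_mono) simp
  note * = ultra_cong[OF this]
  have dom: "domI UP = ucls U Ifun ` Ifun" by (simp add: ultraprod_def)
  have "evi UP e ei s \<in> domI UP" "evi UP e ei t \<in> domI UP"
    using IEq los_itrm by auto
  note ** = eq_iff_rep[OF this[unfolded dom]]
  show ?case unfolding psat.simps ** * ..
next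
  case (ILess s t)
  have "{i. rep (evi UP e ei s) i = evi (FP i) (\<lambda>n. rep (e n) i) (\<lambda>n. rep (ei n) i) s \<and>
      rep (evi UP e ei t) i = evi (FP i) (\<lambda>n. rep (e n) i) (\<lambda>n. rep (ei n) i) t} \<in> U"
    using ILess los_itrm by (simp add: ultra_conj)
  then have "{i. (rep (evi UP e ei s) i < rep (evi UP e ei t) i) =
      (evi (FP i) (\<lambda>n. rep (e n) i) (\<lambda>n. rep (ei n) i) s < evi (FP i) (\<lambda>n. rep (e n) i) (\<lambda>n. rep (ei n) i) t)} \<in> U"
    by (rule ultra_mono) simp
  note * = ultra_cong[OF this]
  have **: "lessI UP x y \<longleftrightarrow> {i. rep x i < rep y i} \<in> U" for x y
    by (simp add: ultraprod_def)
  show ?case unfolding psat.simps ** * fin_plus_simps ..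
next
  case (PNeg \<psi>)
  then show ?case by (simp add: ultra_not)
next
  case (PConj \<psi> \<chi>)
  then show ?case by (simp add: ultra_conj)
next
  case (PExG n \<psi>)
  have upd: "(\<lambda>m. rep ((e(n := c)) m) i) = (\<lambda>m. rep (e m) i)(n := rep c i)" for c i by auto
  have IH: "psat UP (e(n := c)) ei \<psi> \<longleftrightarrow>
      {i. psat (FP i) ((\<lambda>m. rep (e m) i)(n := rep c i)) (\<lambda>m. rep (ei m) i) \<psi>} \<in> U" if "c \<in> domG UP" for c
    unfolding upd[symmetric] by (rule PExG.IH) (use PExG.prems that in auto)
  have dom: "domG UP = ucls U (Dfun D) ` Dfun D" by (simp add: ultraprod_def)
  show ?case
  proof
    assume "psat UP e ei (PExG n \<psi>)"
    then obtain c where c: "c \<in> domG UP" "psat UP (e(n := c)) ei \<psi>" by auto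
    have "rep c \<in> Dfun D" using c(1) unfolding dom by (rule rep_in)
    then have "rep c i \<in> D i" for i by (simp add: Dfun_def)
    then show "{i. psat (FP i) (\<lambda>n. rep (e n) i) (\<lambda>n. rep (ei n) i) (PExG n \<psi>)} \<in> U"
      by (intro ultra_mono[OF IH[OF c(1), THEN iffD1, OF c(2)]]) auto
  next
    assume u: "{i. psat (FP i) (\<lambda>n. rep (e n) i) (\<lambda>n. rep (ei n) i) (PExG n \<psi>)} \<in> U"
    \<comment> \<open>At indices without a witness any element will do; the domains are nonempty, so
      the choice yields a function in \<open>Dfun D\<close>.\<close>
    have "\<forall>i. \<exists>a. a \<in> D i \<and> (psat (FP i) (\<lambda>n. rep (e n) i) (\<lambda>n. rep (ei n) i) (PExG n \<psi>) \<longrightarrow>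
        psat (FP i) ((\<lambda>m. rep (e m) i)(n := a)) (\<lambda>m. rep (ei m) i) \<psi>)" (is "\<forall>i. \<exists>a. ?Q i a")
    proof
      fix i
      show "\<exists>a. ?Q i a"
      proof (cases "psat (FP i) (\<lambda>n. rep (e n) i) (\<lambda>n. rep (ei n) i) (PExG n \<psi>)")
      case False
      then show ?thesis using ok[of i] by (auto simp: lstruct_ok_def)
      qed auto
    qed
    from choice[OF this] obtain f where f: "\<And>i. f i \<in> D i" "\<And>i. psat (FP i) (\<lambda>n. rep (e n) i) (\<lambda>n. rep (ei n) i) (PExG n \<psi>) \<Longrightarrow>
        psat (FP i) ((\<lambda>m. rep (e m) i)(n := f i)) (\<lambda>m. rep (ei m) i) \<psi>" by blast
    have fD: "f \<in> Dfun D" using f by (simp add: Dfun_def)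
    let ?c = "ucls U (Dfun D) f"
    have "{i. psat (FP i) ((\<lambda>m. rep (e m) i)(n := rep ?c i)) (\<lambda>m. rep (ei m) i) \<psi>} \<in> U"
      by (rule ultra_mono2[OF rep_ucls(2)[OF fD] u]) (use f(2) in auto)
    moreover have "?c \<in> domG UP" using fD dom by blast
    ultimately have "psat UP (e(n := ?c)) ei \<psi>" "?c \<in> domG UP" using IH by simp_all
    then show "psat UP e ei (PExG n \<psi>)" by (simp only: psat.simps) (rule bexI)
  qed
next
  case (PExI n \<psi>)
  have upd: "(\<lambda>m. rep ((ei(n := c)) m) i) = (\<lambda>m. rep (ei m) i)(n := rep c i)" for c i by auto
  have IH: "psat UP e (ei(n := c)) \<psi> \<longleftrightarrow>
      {i. psat (FP i) (\<lambda>m. rep (e m) i) ((\<lambda>m. rep (ei m) i)(n := rep c i)) \<psi>} \<in> U" if "c \<in> domI UP" for c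
    unfolding upd[symmetric] by (rule PExI.IH) (use PExI.prems that in auto)
  have dom: "domI UP = ucls U Ifun ` Ifun" by (simp add: ultraprod_def)
  show ?case
  proof
    assume "psat UP e ei (PExI n \<psi>)"
    then obtain c where c: "c \<in> domI UP" "psat UP e (ei(n := c)) \<psi>" by auto
    have "rep c \<in> Ifun" using c(1) unfolding dom by (rule rep_in)
    then have "rep c i \<in> {0..1}" for i by (simp add: Ifun_def)
    then show "{i. psat (FP i) (\<lambda>n. rep (e n) i) (\<lambda>n. rep (ei n) i) (PExI n \<psi>)} \<in> U"
      by (intro ultra_mono[OF IH[OF c(1), THEN iffD1, OF c(2)]]) auto
  next
    assume u: "{i. psat (FP i) (\<lambda>n. rep (e n) i) (\<lambda>n. rep (ei n) i) (PExI n \<psi>)} \<in> U"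
    have "\<forall>i. \<exists>a. a \<in> {0..1} \<and> (psat (FP i) (\<lambda>n. rep (e n) i) (\<lambda>n. rep (ei n) i) (PExI n \<psi>) \<longrightarrow>
        psat (FP i) (\<lambda>m. rep (e m) i) ((\<lambda>m. rep (ei m) i)(n := a)) \<psi>)" (is "\<forall>i. \<exists>a. ?Q i a")
    proof
      fix i
      show "\<exists>a. ?Q i a"
      proof (cases "psat (FP i) (\<lambda>n. rep (e n) i) (\<lambda>n. rep (ei n) i) (PExI n \<psi>)")
      case False
      then show ?thesis by (intro exI[of _ 0]) simp
      qed auto
    qed
    from choice[OF this] obtain f where f: "\<And>i. f i \<in> {0..1}" "\<And>i. psat (FP i) (\<lambda>n. rep (e n) i) (\<lambda>n. rep (ei n) i) (PExI n \<psi>) \<Longrightarrow>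
        psat (FP i) (\<lambda>m. rep (e m) i) ((\<lambda>m. rep (ei m) i)(n := f i)) \<psi>" by blast
    have fD: "f \<in> Ifun" using f by (simp add: Ifun_def)
    let ?c = "ucls U Ifun f"
    have "{i. psat (FP i) (\<lambda>m. rep (e m) i) ((\<lambda>m. rep (ei m) i)(n := rep ?c i)) \<psi>} \<in> U"
      by (rule ultra_mono2[OF rep_ucls(2)[OF fD] u]) (use f(2) in auto)
    moreover have "?c \<in> domI UP" using fD dom by blast
    ultimately have "psat UP e (ei(n := ?c)) \<psi>" "?c \<in> domI UP" using IH by simp_all
    then show "psat UP e ei (PExI n \<psi>)" by (simp only: psat.simps) (rule bexI)
  qed
qed

text \<open>The group variables of \<psi> are closed universally before passing to G, because the
  values of \<open>e\<close> need not come from the ultraproduct. The I-variables are instead fixed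
  at a class that does come from it, that of the constant \<open>r\<close>, whose representative
  equals \<open>r\<close> on a set in \<open>U\<close>.\<close>

lemma psat_transfer:
  assumes ext: "elem_emb ar rar UP G hG hI"
    and wf: "wf_pfm ar rar \<psi>" and M: "gfv \<psi> \<subseteq> {..<M}" and r: "r \<in> {0..1}"
    and true: "\<And>i e. range e \<subseteq> D i \<Longrightarrow> psat (FP i) e (\<lambda>_. r) \<psi>"
    and e: "range e \<subseteq> domG G"
  shows "psat G e (\<lambda>_. hI (ucls U Ifun (\<lambda>_. r))) \<psi>"
proof -
  let ?c = "ucls U Ifun (\<lambda>_. r)"
  define \<chi> where "\<chi> = PNeg (PExs [0..<M] (PNeg \<psi>))"
  have dom: "domG UP = ucls U (Dfun D) ` Dfun D" "domI UP = ucls U Ifun ` Ifun"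
    by (simp_all add: ultraprod_def)
  have rI: "(\<lambda>_. r) \<in> Ifun" using r by (simp add: Ifun_def)
  have "(\<lambda>i. SOME a. a \<in> D i) \<in> Dfun D"
    using ok by (auto simp: Dfun_def lstruct_ok_def some_in_eq)
  \<comment> \<open>A dummy environment: all group variables of \<chi> are bound.\<close>
  then obtain d where d: "d \<in> domG UP" using dom by blast
  have wfc: "wf_pfm ar rar \<chi>" using wf by (simp add: \<chi>_def wf_pfm_PExs)
  have ei: "range (\<lambda>_::nat. ?c) \<subseteq> domI UP" using rI dom by auto
  have "{i. rep ?c i = r} \<in> U" using rep_ucls[OF rI] by simp
  then have "{i. psat (FP i) (\<lambda>n. rep d i) (\<lambda>n. rep ?c i) \<chi>} \<in> U"
  proof (rule ultra_mono)
    fix i assume ri: "rep ?c i = r"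
    have "rep d i \<in> D i" using rep_in[of d "Dfun D"] d dom by (simp add: Dfun_def)
    then have "psat (FP i) (override_on (\<lambda>n. rep d i) f (set [0..<M])) (\<lambda>_. r) \<psi>"
      if "\<forall>m\<in>set [0..<M]. f m \<in> domG (FP i)" for f
      using that by (intro true) (auto simp: override_on_def)
    then show "psat (FP i) (\<lambda>n. rep d i) (\<lambda>n. rep ?c i) \<chi>"
      unfolding \<chi>_def ri psat.simps psat_PExs by blast
  qed
  then have "psat UP (\<lambda>_. d) (\<lambda>_. ?c) \<chi>"
    using los[OF wfc _ ei, of "\<lambda>_. d"] d by auto
  moreover have "psat UP (\<lambda>_. d) (\<lambda>_. ?c) \<chi> \<Longrightarrow> psat G (hG \<circ> (\<lambda>_. d)) (hI \<circ> (\<lambda>_. ?c)) \<chi>"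
  proof -
    have "wf_pfm ar rar \<chi> \<and> range (\<lambda>_::nat. d) \<subseteq> domG UP \<and> range (\<lambda>_::nat. ?c) \<subseteq> domI UP"
      using wfc ei d by auto
    then have "psat UP (\<lambda>_. d) (\<lambda>_. ?c) \<chi> \<longleftrightarrow> psat G (hG \<circ> (\<lambda>_. d)) (hI \<circ> (\<lambda>_. ?c)) \<chi>"
      using ext[unfolded elem_emb_def, THEN conjunct2, THEN conjunct2, rule_format] by blast
    then show "psat UP (\<lambda>_. d) (\<lambda>_. ?c) \<chi> \<Longrightarrow> psat G (hG \<circ> (\<lambda>_. d)) (hI \<circ> (\<lambda>_. ?c)) \<chi>" ..
  qed
  ultimately have "psat G (override_on (hG \<circ> (\<lambda>_. d)) e (set [0..<M])) (hI \<circ> (\<lambda>_. ?c)) \<psi>"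
    using e unfolding \<chi>_def psat.simps psat_PExs by blast
  then have "psat G e (hI \<circ> (\<lambda>_. ?c)) \<psi>"
    by (subst psat_cong[where e' = "override_on (hG \<circ> (\<lambda>_. d)) e (set [0..<M])"])
       (use M in \<open>auto simp: override_on_def\<close>)
  then show ?thesis by (simp add: comp_def)
qed

end
end

section \<open>Expressing shattering and uniform counts\<close>

text \<open>Failure of NIP at \<open>k\<close>, the parameter \<open>b\<close> being the left
  factor. An existential quantifier for each \<open>J\<close> replaces the function of
  \<open>J\<close>, so that a fixed \<open>k\<close> gives a first-order sentence.\<close>

definition shattering :: "'a set \<Rightarrow> ('a \<Rightarrow> 'a \<Rightarrow> 'a) \<Rightarrow> ('a \<Rightarrow> bool) \<Rightarrow> nat \<Rightarrow> bool" where
  "shattering D mul X k \<longleftrightarrow> (\<exists>a. (\<forall>i<k. a i \<in> D) \<and>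
     (\<forall>J\<subseteq>{..<k}. \<exists>b\<in>D. \<forall>i<k. i \<in> J \<longleftrightarrow> X (mul b (a i))))"

text \<open>\<open>K\<close> holds the admissible numbers of hits. It absorbs all real arithmetic,
  and the formula has to name only finitely many subsets of \<open>{..<N}\<close>.\<close>

definition uniform_count :: "'a set \<Rightarrow> ('a \<Rightarrow> 'a \<Rightarrow> 'a) \<Rightarrow> ('a \<Rightarrow> bool) \<Rightarrow> nat \<Rightarrow> nat set \<Rightarrow> bool" where
  "uniform_count D mul X N K \<longleftrightarrow> (\<exists>a. (\<forall>i<N. a i \<in> D) \<and>
     (\<forall>g\<in>D. card {i. i < N \<and> X (mul (a i) g)} \<in> K))"

lemma finite_fv_trm: "finite (fv_trm t)"
  by (induction t) auto

lemma finite_fv_fm: "finite (fv_fm \<phi>)"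
  by (induction \<phi>) (auto simp: finite_fv_trm)

lemma fv_less_nfv: "n \<in> fv_fm \<phi> \<Longrightarrow> n < nfv \<phi>"
  unfolding nfv_def less_Suc_eq_le by (intro Max_ge) (auto simp: finite_fv_fm)

lemma nfv_pos: "0 < nfv \<phi>"
  by (simp add: nfv_def)

text \<open>Puts a product of two variables for variable 0 without a substitution operation. The
  quantifier captures 0, so \<open>u\<close> and \<open>v\<close> have to differ from it.\<close>

definition product_fm :: "('f, 'r) fm \<Rightarrow> 'f \<Rightarrow> nat \<Rightarrow> nat \<Rightarrow> ('f, 'r) pfm" where
  "product_fm \<phi> m u v = PExG 0 (PConj (PEq (Var 0) (Fn m [Var u, Var v])) (emb \<phi>))"

lemma psat_product_fm:
  assumes "u \<noteq> 0" "v \<noteq> 0" "fnG S m [e u, e v] \<in> domG S"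
  shows "psat S e ei (product_fm \<phi> m u v) \<longleftrightarrow>
    satL (domG S) (fnG S) (relG S) (e(0 := fnG S m [e u, e v])) \<phi>"
  using assms by (auto simp: product_fm_def psat_emb)

text \<open>Encoding: the bound variable is \<open>nfv \<phi>\<close> and the given elements are the values of the variables
  \<open>nfv \<phi> + 1 + i\<close>, \<open>i < n\<close>, all of them fresh for \<open>\<phi>\<close>; the flag \<open>s\<close> says whether the bound variable is
  the left factor (as in shattering) or the right one (as in uniform counts).\<close>

definition pattern_fm :: "('f, 'r) fm \<Rightarrow> 'f \<Rightarrow> bool \<Rightarrow> nat \<Rightarrow> nat set \<Rightarrow> ('f, 'r) pfm" where
  "pattern_fm \<phi> m s n J = (let p = nfv \<phi> in PExG p (PConjs (map (\<lambda>i. PLit (i \<in> J)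
     (product_fm \<phi> m (if s then p else p + 1 + i) (if s then p + 1 + i else p))) [0..<n])))"

lemma psat_pattern_fm:
  assumes "\<forall>x\<in>domG S. \<forall>y\<in>domG S. fnG S m [x, y] \<in> domG S"
    and "\<And>i. i < n \<Longrightarrow> e (nfv \<phi> + 1 + i) = a i" "\<And>i. i < n \<Longrightarrow> a i \<in> domG S"
    and "\<And>j. j < nfv \<phi> \<Longrightarrow> e j = e' j"
  shows "psat S e ei (pattern_fm \<phi> m s n J) \<longleftrightarrow> (\<exists>b\<in>domG S. \<forall>i<n. i \<in> J \<longleftrightarrow>
    satL (domG S) (fnG S) (relG S) (e'(0 := fnG S m (if s then [b, a i] else [a i, b]))) \<phi>)"
proof -
  let ?p = "nfv \<phi>"
  have "psat S (e(?p := b)) ei (product_fm \<phi> m (if s then ?p else ?p + 1 + i) (if s then ?p + 1 + i else ?p)) \<longleftrightarrow>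
      satL (domG S) (fnG S) (relG S) (e'(0 := fnG S m (if s then [b, a i] else [a i, b]))) \<phi>"
    if "b \<in> domG S" "i < n" for b i
  proof -
    let ?u = "if s then ?p else ?p + 1 + i" and ?v = "if s then ?p + 1 + i else ?p"
    have v: "[(e(?p := b)) ?u, (e(?p := b)) ?v] = (if s then [b, a i] else [a i, b])"
      using assms(2)[OF that(2)] by simp
    have "psat S (e(?p := b)) ei (product_fm \<phi> m ?u ?v) \<longleftrightarrow>
      satL (domG S) (fnG S) (relG S) ((e(?p := b))(0 := fnG S m (if s then [b, a i] else [a i, b]))) \<phi>"
      unfolding v[symmetric]
    proof (rule psat_product_fm)
      show "fnG S m [(e(?p := b)) ?u, (e(?p := b)) ?v] \<in> domG S"
        unfolding v using assms(1) assms(3)[OF that(2)] that(1) by simp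
    qed (use nfv_pos[of \<phi>] in auto)
    also have "\<dots> \<longleftrightarrow> satL (domG S) (fnG S) (relG S) (e'(0 := fnG S m (if s then [b, a i] else [a i, b]))) \<phi>"
    proof (rule satL_cong)
      fix j assume "j \<in> fv_fm \<phi>"
      then have "j < ?p" by (rule fv_less_nfv)
      then show "((e(?p := b))(0 := fnG S m (if s then [b, a i] else [a i, b]))) j
          = (e'(0 := fnG S m (if s then [b, a i] else [a i, b]))) j"
        using assms(4) by simp
    qed
    finally show ?thesis .
  qed
  then show ?thesis
    unfolding pattern_fm_def Let_def psat.simps psat_PConjs by (auto simp: PLit_simps simp del: One_nat_def)
qed

text \<open>Common form of the two properties: shattering asks that every listed pattern occurs, a
  uniform count that none of the listed ones does.\<close>

definition patterns_fm :: "('f, 'r) fm \<Rightarrow> 'f \<Rightarrow> bool \<Rightarrow> bool \<Rightarrow> nat \<Rightarrow> nat list list \<Rightarrow> ('f, 'r) pfm" where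
  "patterns_fm \<phi> m s b n Js = PExs [nfv \<phi> + 1..<nfv \<phi> + 1 + n] (PConjs (map (\<lambda>J. PLit b (pattern_fm \<phi> m s n (set J))) Js))"

lemma psat_patterns_fm:
  assumes "\<forall>x\<in>domG S. \<forall>y\<in>domG S. fnG S m [x, y] \<in> domG S"
  shows "psat S e ei (patterns_fm \<phi> m s t n Js) \<longleftrightarrow> (\<exists>a. (\<forall>i<n. a i \<in> domG S) \<and>
    (\<forall>J\<in>set ` set Js. t \<longleftrightarrow> (\<exists>b\<in>domG S. \<forall>i<n. i \<in> J \<longleftrightarrow>
    satL (domG S) (fnG S) (relG S) (e(0 := fnG S m (if s then [b, a i] else [a i, b]))) \<phi>)))"
    (is "_ \<longleftrightarrow> (\<exists>a. ?A a \<and> (\<forall>J\<in>set ` set Js. ?Q a J))")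
proof -
  let ?p = "nfv \<phi>" and ?I = "set [nfv \<phi> + 1..<nfv \<phi> + 1 + n]"
  have eq: "psat S (override_on e f ?I) ei (PLit t (pattern_fm \<phi> m s n (set J))) \<longleftrightarrow> ?Q a (set J)"
    if "?A a" "\<And>i. i < n \<Longrightarrow> f (?p + 1 + i) = a i" for f a J
  proof -
    have "psat S (override_on e f ?I) ei (pattern_fm \<phi> m s n (set J)) \<longleftrightarrow> (\<exists>b\<in>domG S. \<forall>i<n. i \<in> set J \<longleftrightarrow>
        satL (domG S) (fnG S) (relG S) (e(0 := fnG S m (if s then [b, a i] else [a i, b]))) \<phi>)"
      using that by (intro psat_pattern_fm assms) (auto simp: override_on_def)
    then show ?thesis by (simp only: PLit_simps)
  qed
  show ?thesis
    unfolding patterns_fm_def psat_PExs psat_PConjs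
  proof
    assume "\<exists>f. (\<forall>j\<in>?I. f j \<in> domG S) \<and>
      (\<forall>\<psi>\<in>set (map (\<lambda>J. PLit t (pattern_fm \<phi> m s n (set J))) Js). psat S (override_on e f ?I) ei \<psi>)"
    then obtain f where f: "\<forall>j\<in>?I. f j \<in> domG S"
      "\<And>J. J \<in> set Js \<Longrightarrow> psat S (override_on e f ?I) ei (PLit t (pattern_fm \<phi> m s n (set J)))" by auto
    have A: "?A (\<lambda>i. f (?p + 1 + i))"
    proof (intro allI impI)
      fix i assume "i < n"
      then have "?p + 1 + i \<in> ?I" unfolding set_upt atLeastLessThan_iff by linarith
      then show "f (?p + 1 + i) \<in> domG S" using f(1) by blast
    qed
    show "\<exists>a. ?A a \<and> (\<forall>J\<in>set ` set Js. ?Q a J)"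
    proof (intro exI conjI)
      show "\<forall>J\<in>set ` set Js. ?Q (\<lambda>i. f (?p + 1 + i)) J" using eq[OF A] f(2) by auto
    qed (rule A)
  next
    assume "\<exists>a. ?A a \<and> (\<forall>J\<in>set ` set Js. ?Q a J)"
    then obtain a where a: "?A a" "\<forall>J\<in>set ` set Js. ?Q a J" by blast
    define f where "f j = a (j - (?p + 1))" for j
    have f: "f (?p + 1 + i) = a i" for i by (simp add: f_def)
    have "\<forall>j\<in>?I. f j \<in> domG S" using a(1) by (auto simp: f_def)
    moreover have "\<forall>\<psi>\<in>set (map (\<lambda>J. PLit t (pattern_fm \<phi> m s n (set J))) Js). psat S (override_on e f ?I) ei \<psi>"
      using eq[OF a(1) f] a(2) by (simp only: list.set_map ball_simps)
    ultimately show "\<exists>f. (\<forall>j\<in>?I. f j \<in> domG S) \<and>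
      (\<forall>\<psi>\<in>set (map (\<lambda>J. PLit t (pattern_fm \<phi> m s n (set J))) Js). psat S (override_on e f ?I) ei \<psi>)" by blast
  qed
qed

lemma wf_pfm_patterns_fm:
  assumes "wf_fm ar rar \<phi>" "ar m = 2"
  shows "wf_pfm ar rar (patterns_fm \<phi> m s t n Js)"
  using assms by (auto simp: patterns_fm_def wf_pfm_PExs wf_pfm_PConjs PLit_simps pattern_fm_def Let_def product_fm_def wf_pfm_emb)

lemma gfv_patterns_fm: "gfv (patterns_fm \<phi> m s t n Js) \<subseteq> {..<nfv \<phi> + 1 + n}"
proof -
  have "gfv (product_fm \<phi> m u v) \<subseteq> {..<nfv \<phi> + 1 + n}" if "u < nfv \<phi> + 1 + n" "v < nfv \<phi> + 1 + n" for u v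
    using that fv_less_nfv[of _ \<phi>] by (force simp: product_fm_def gfv_emb)
  then have "gfv (product_fm \<phi> m (if s then nfv \<phi> else nfv \<phi> + 1 + i) (if s then nfv \<phi> + 1 + i else nfv \<phi>))
      \<subseteq> {..<nfv \<phi> + 1 + n}" if "i < n" for i
    using that by simp
  then have "gfv (pattern_fm \<phi> m s n J) \<subseteq> {..<nfv \<phi> + 1 + n}" for J
    unfolding pattern_fm_def Let_def gfv.simps gfv_PConjs set_map UN_simps PLit_simps by (auto; fastforce)
  then show ?thesis
    unfolding patterns_fm_def gfv_PExs gfv_PConjs by (auto simp: PLit_simps)
qed

definition shattering_fm :: "('f, 'r) fm \<Rightarrow> 'f \<Rightarrow> nat \<Rightarrow> ('f, 'r) pfm" where
  "shattering_fm \<phi> m k = patterns_fm \<phi> m True True k (subseqs [0..<k])"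

definition uniform_count_fm :: "('f, 'r) fm \<Rightarrow> 'f \<Rightarrow> nat \<Rightarrow> nat set \<Rightarrow> ('f, 'r) pfm" where
  "uniform_count_fm \<phi> m N K = patterns_fm \<phi> m False False N (filter (\<lambda>J. card (set J) \<notin> K) (subseqs [0..<N]))"

lemma set_subseqs_upt: "set ` set (subseqs [0..<n]) = Pow {..<n}"
  by (simp add: subseqs_powset atLeast0LessThan)

lemma psat_shattering_fm:
  assumes "\<forall>x\<in>domG S. \<forall>y\<in>domG S. fnG S m [x, y] \<in> domG S"
  shows "psat S e ei (shattering_fm \<phi> m k) \<longleftrightarrow> shattering (domG S) (\<lambda>x y. fnG S m [x, y])
     (\<lambda>x. satL (domG S) (fnG S) (relG S) (e(0 := x)) \<phi>) k"
  unfolding shattering_fm_def psat_patterns_fm[OF assms] set_subseqs_upt shattering_def by (simp add: Ball_def)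

text \<open>Each \<open>b\<close> realises exactly one subset of \<open>{..<N}\<close>, so
  restricting its size amounts to excluding every subset of a wrong size.\<close>

lemma forbidden_patterns_iff:
  "(\<forall>J\<in>{J \<in> Pow {..<N}. card J \<notin> K}. False \<longleftrightarrow> (\<exists>b\<in>C. \<forall>i<N. i \<in> J \<longleftrightarrow> Q b i)) \<longleftrightarrow>
      (\<forall>b\<in>C. card {i. i < N \<and> Q b i} \<in> K)"
proof
  assume l: "\<forall>J\<in>{J \<in> Pow {..<N}. card J \<notin> K}. False \<longleftrightarrow> (\<exists>b\<in>C. \<forall>i<N. i \<in> J \<longleftrightarrow> Q b i)"
  show "\<forall>b\<in>C. card {i. i < N \<and> Q b i} \<in> K"
  proof (rule ballI, rule ccontr)
    fix b assume b: "b \<in> C" "card {i. i < N \<and> Q b i} \<notin> K"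
    have "{i. i < N \<and> Q b i} \<subseteq> {..<N}" by auto
    with l b(2) have "\<not> (\<exists>b'\<in>C. \<forall>i<N. i \<in> {i. i < N \<and> Q b i} \<longleftrightarrow> Q b' i)" by blast
    then show False using b(1) by auto
  qed
next
  assume r: "\<forall>b\<in>C. card {i. i < N \<and> Q b i} \<in> K"
  have False if J: "J \<subseteq> {..<N}" "card J \<notin> K" "\<exists>b\<in>C. \<forall>i<N. i \<in> J \<longleftrightarrow> Q b i" for J
  proof -
    from J(3)
    obtain b where b: "b \<in> C" "\<forall>i<N. i \<in> J \<longleftrightarrow> Q b i" by blast
    then have "J = {i. i < N \<and> Q b i}" using J(1) by auto
    then show False using r b(1) J(2) by simp
  qed
  then show "\<forall>J\<in>{J \<in> Pow {..<N}. card J \<notin> K}. False \<longleftrightarrow> (\<exists>b\<in>C. \<forall>i<N. i \<in> J \<longleftrightarrow> Q b i)" by blast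
qed

lemma psat_uniform_count_fm:
  assumes "\<forall>x\<in>domG S. \<forall>y\<in>domG S. fnG S m [x, y] \<in> domG S"
  shows "psat S e ei (uniform_count_fm \<phi> m N K) \<longleftrightarrow> uniform_count (domG S) (\<lambda>x y. fnG S m [x, y])
     (\<lambda>x. satL (domG S) (fnG S) (relG S) (e(0 := x)) \<phi>) N K"
proof -
  have *: "set ` set (filter (\<lambda>J. card (set J) \<notin> K) (subseqs [0..<N])) = {J \<in> Pow {..<N}. card J \<notin> K}"
    unfolding set_subseqs_upt[symmetric] by auto
  show ?thesis
    unfolding uniform_count_fm_def psat_patterns_fm[OF assms] uniform_count_def * forbidden_patterns_iff by simp
qed

text \<open>Variable 0 is the counted one and the parameters are passed in their own order, so every
  variable of \<phi> keeps its number. \<open>IVar 0\<close> will take the threshold.\<close>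

definition measure_less_fm :: "('f, 'r) fm \<Rightarrow> ('f, 'r) pfm" where
  "measure_less_fm \<phi> = ILess (Mu \<phi> 1 (map Var [1..<nfv \<phi>])) (IVar 0)"

lemma psat_measure_less_fm: "psat S e ei (measure_less_fm \<phi>) \<longleftrightarrow> lessI S (muI S \<phi> 1 (map e [1..<nfv \<phi>])) (ei 0)"
  by (simp add: measure_less_fm_def comp_def)

lemma wf_pfm_measure_less_fm: "wf_fm ar rar \<phi> \<Longrightarrow> wf_pfm ar rar (measure_less_fm \<phi>)"
  using fv_less_nfv[of _ \<phi>] nfv_pos[of \<phi>] by (auto simp: measure_less_fm_def)

lemma gfv_measure_less_fm: "gfv (measure_less_fm \<phi>) \<subseteq> {..<nfv \<phi>}"
  by (auto simp: measure_less_fm_def)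

lemma fin_mu_eq:
  "fin_mu D F R \<phi> 1 (map e [1..<nfv \<phi>]) = card {x\<in>D. satL D F R (e(0 := x)) \<phi>} / card D"
proof -
  have eq: "satL D F R (fenv D 1 [x] (map e [1..<nfv \<phi>])) \<phi> = satL D F R (e(0 := x)) \<phi>" for x
  proof (rule satL_cong)
    fix j assume "j \<in> fv_fm \<phi>"
    then have "j < nfv \<phi>" by (rule fv_less_nfv)
    then show "fenv D 1 [x] (map e [1..<nfv \<phi>]) j = (e(0 := x)) j"
      by (auto simp: fenv_def)
  qed
  have "{as. length as = 1 \<and> set as \<subseteq> D \<and> satL D F R (fenv D 1 as (map e [1..<nfv \<phi>])) \<phi>}
      = (\<lambda>x. [x]) ` {x\<in>D. satL D F R (e(0 := x)) \<phi>}" (is "?l = ?r")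
  proof (intro equalityI subsetI)
    fix as assume as: "as \<in> ?l"
    then obtain x where "as = [x]" by (auto simp: length_Suc_conv)
    then show "as \<in> ?r" using as eq by auto
  next
    fix as assume "as \<in> ?r"
    then show "as \<in> ?l" using eq by auto
  qed
  then have "card {as. length as = 1 \<and> set as \<subseteq> D \<and> satL D F R (fenv D 1 as (map e [1..<nfv \<phi>])) \<phi>}
      = card {x\<in>D. satL D F R (e(0 := x)) \<phi>}"
    by (simp only:) (rule card_image, simp add: inj_on_def)
  then show ?thesis by (simp only: fin_mu_def power_one_right)
qed

section \<open>Uniform counts in finite groups\<close>

text \<open>\<open>T g\<close> is a right translate, so all \<open>T g\<close> have the same size
  and one density serves them all. The assumption on \<open>k\<close> concerns the dual family:
  \<open>2 ^ k\<close> points shattered by the sets \<open>T g\<close> can be labelled by the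
  subsets \<open>J\<close> of \<open>{..<k}\<close>, and a \<open>g\<close> whose \<open>T g\<close>
  cuts out the labels containing \<open>i\<close> supplies \<open>a i\<close>. This is the origin of
  \<open>2 ^ k\<close> in \<open>large\<close>.\<close>

lemma finite_group_uniform_count:
  fixes D :: "'a set" and \<epsilon> :: real and N k :: nat
  assumes grp: "group \<lparr>carrier = D, mult = mul, one = u\<rparr>" and fin: "finite D"
    and ns: "\<not> shattering D mul X k" and eps: "0 < \<epsilon>" "\<epsilon> \<le> 1" and N: "0 < N"
    and large: "ln (real (2 * (2 ^ k * (2 * N + 1) ^ (2 ^ k)))) < real N * \<epsilon>\<^sup>2 / 4"
    and K: "\<And>n. \<bar>real n - N * (card {x\<in>D. X x} / card D)\<bar> \<le> N * \<epsilon> \<Longrightarrow> n \<in> K"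
  shows "uniform_count D mul X N K"
proof -
  interpret group "\<lparr>carrier = D, mult = mul, one = u\<rparr>" by (rule grp)
  define T where "T g = {y\<in>D. X (mul y g)}" for g
  have ne: "D \<noteq> {}" using one_closed by auto
  have cT: "card (T g) = card {x\<in>D. X x}" if g: "g \<in> D" for g
  proof -
    have inj: "inj_on (\<lambda>y. mul y g) D" using inj_on_multc[of g] g by simp
    have "(\<lambda>y. mul y g) ` D = D"
      by (rule endo_inj_surj[OF fin _ inj]) (use m_closed g in auto)
    then have "(\<lambda>y. mul y g) ` T g = {x\<in>D. X x}"
      by (auto simp: T_def image_iff)
    moreover have "inj_on (\<lambda>y. mul y g) (T g)" using inj by (rule inj_on_subset) (auto simp: T_def)
    ultimately show ?thesis by (metis card_image)
  qed
  have "card S < 2 ^ k" if S: "S \<subseteq> D" "shatters (T ` D) S" for S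
  proof (rule ccontr)
    assume "\<not> card S < 2 ^ k"
    then have "card (Pow {..<k}) \<le> card S" by (simp add: card_Pow)
    moreover have "finite S" using S fin finite_subset by auto
    ultimately obtain f where f: "f ` Pow {..<k} \<subseteq> S" "inj_on f (Pow {..<k})"
      using card_le_inj[of "Pow {..<k}" S] by auto
    have "\<exists>g\<in>D. T g \<inter> S = f ` {J \<in> Pow {..<k}. i \<in> J}" for i
    proof -
      have "f ` {J \<in> Pow {..<k}. i \<in> J} \<subseteq> S" using f(1) by auto
      then show ?thesis using S(2) unfolding shatters_def by blast
    qed
    then obtain a where a: "\<And>i. a i \<in> D" "\<And>i. T (a i) \<inter> S = f ` {J \<in> Pow {..<k}. i \<in> J}" by metis
    have "i \<in> J \<longleftrightarrow> X (mul (f J) (a i))" if J: "J \<subseteq> {..<k}" for i J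
    proof -
      have fJ: "f J \<in> S" "f J \<in> D" using f(1) J S(1) by auto
      have "X (mul (f J) (a i)) \<longleftrightarrow> f J \<in> T (a i) \<inter> S" using fJ by (simp add: T_def)
      also have "\<dots> \<longleftrightarrow> i \<in> J" unfolding a(2) using J f(2) by (auto simp: inj_on_def)
      finally show ?thesis by simp
    qed
    moreover have "f J \<in> D" if "J \<subseteq> {..<k}" for J using f(1) that S(1) by auto
    ultimately have "shattering D mul X k" unfolding shattering_def using a(1) by metis
    then show False using ns by simp
  qed
  then obtain x where x: "\<forall>i<N. x i \<in> D"
    "\<forall>S\<in>T ` D. \<bar>card {i. i < N \<and> x i \<in> S} - N * (card S / card D)\<bar> \<le> N * \<epsilon>"
    using uniform_sample_exists[OF fin ne _ _ eps N large, of "T ` D"] by (auto simp: T_def)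
  have "card {i. i < N \<and> X (mul (x i) g)} \<in> K" if g: "g \<in> D" for g
  proof (rule K)
    have "{i. i < N \<and> X (mul (x i) g)} = {i. i < N \<and> x i \<in> T g}" using x(1) by (auto simp: T_def)
    then show "\<bar>card {i. i < N \<and> X (mul (x i) g)} - N * (card {x\<in>D. X x} / card D)\<bar> \<le> N * \<epsilon>"
      using x(2) g cT[OF g] by auto
  qed
  then show ?thesis unfolding uniform_count_def using x(1) by blast
qed

section \<open>Finitely additive measures\<close>

text \<open>Integrates a sum of indicators inside the algebra, without an integral. The induction
  splits \<open>Z\<close> along the last set: on \<open>Z \<inter> Y N\<close> that set accounts for
  \<open>s\<close> and leaves the bound \<open>u - s\<close>, which is why \<open>Z\<close> and
  \<open>u\<close> vary. The sign of \<open>s\<close> is free, so lower bounds are included.\<close>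

lemma sum_measure_scaled_le:
  fixes Y :: "nat \<Rightarrow> 'a set" and s u :: real
  assumes alg: "bool_alg \<Omega> \<B>" and prob: "fin_add_prob \<Omega> \<B> \<nu>"
    and Y: "\<And>i. i < N \<Longrightarrow> Y i \<in> \<B>" and Z: "Z \<in> \<B>"
    and le: "\<And>g. g \<in> Z \<Longrightarrow> s * card {i. i < N \<and> g \<in> Y i} \<le> u"
  shows "s * (\<Sum>i<N. \<nu> (Y i \<inter> Z)) \<le> u * \<nu> Z"
proof -
  have compl: "\<And>A. A \<in> \<B> \<Longrightarrow> \<Omega> - A \<in> \<B>" and un: "\<And>A B. A \<in> \<B> \<Longrightarrow> B \<in> \<B> \<Longrightarrow> A \<union> B \<in> \<B>"
    and sub: "\<And>A. A \<in> \<B> \<Longrightarrow> A \<subseteq> \<Omega>" and emp: "{} \<in> \<B>"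
    using alg by (auto simp: bool_alg_def)
  have int: "A \<inter> B \<in> \<B>" if "A \<in> \<B>" "B \<in> \<B>" for A B
  proof -
    have "A \<inter> B = \<Omega> - ((\<Omega> - A) \<union> (\<Omega> - B))" using sub that by blast
    then show ?thesis using compl un that by simp
  qed
  have diff: "A - B \<in> \<B>" if "A \<in> \<B>" "B \<in> \<B>" for A B
  proof -
    have "A - B = A \<inter> (\<Omega> - B)" using sub that by blast
    then show ?thesis using int compl that by simp
  qed
  have add: "\<nu> (A \<union> B) = \<nu> A + \<nu> B" if "A \<in> \<B>" "B \<in> \<B>" "A \<inter> B = {}" for A B
    using prob that by (auto simp: fin_add_prob_def)
  have nonneg: "0 \<le> \<nu> A" if "A \<in> \<B>" for A using prob that by (auto simp: fin_add_prob_def)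
  have empty0: "\<nu> {} = 0" using add[of "{}" "{}"] emp by simp
  have split: "\<nu> A = \<nu> (A \<inter> B) + \<nu> (A - B)" if "A \<in> \<B>" "B \<in> \<B>" for A B
  proof -
    have "(A \<inter> B) \<union> (A - B) = A" "(A \<inter> B) \<inter> (A - B) = {}" by auto
    then show ?thesis using add[of "A \<inter> B" "A - B"] int diff that by simp
  qed
  show ?thesis using Y Z le
  proof (induction N arbitrary: Z u)
    case 0
    show ?case
    \<comment> \<open>On the empty set nothing prevents \<open>u\<close> from being negative, but
      then the measure is 0.\<close>
    proof (cases "Z = {}")
      case False
      then have "0 \<le> u" using 0 by auto
      then show ?thesis using nonneg[OF 0(2)] by simp
    qed (simp add: empty0)
  next
    case (Suc N)
    let ?Y = "Y N"
    have YN: "?Y \<in> \<B>" using Suc.prems by simp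
    have c: "{i. i < Suc N \<and> g \<in> Y i} = (if g \<in> ?Y then insert N {i. i < N \<and> g \<in> Y i} else {i. i < N \<and> g \<in> Y i})" for g
      by (auto simp: less_Suc_eq)
    have c1: "card {i. i < Suc N \<and> g \<in> Y i} = Suc (card {i. i < N \<and> g \<in> Y i})" if "g \<in> ?Y" for g
      unfolding c using that by simp
    have c2: "card {i. i < Suc N \<and> g \<in> Y i} = card {i. i < N \<and> g \<in> Y i}" if "g \<notin> ?Y" for g
      unfolding c using that by simp
    have h1: "s * (\<Sum>i<N. \<nu> (Y i \<inter> (Z \<inter> ?Y))) \<le> (u - s) * \<nu> (Z \<inter> ?Y)"
    proof (rule Suc.IH)
      fix g assume g: "g \<in> Z \<inter> ?Y"
      then show "s * card {i. i < N \<and> g \<in> Y i} \<le> u - s"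
        using Suc.prems(3)[of g] c1[of g] by (simp add: algebra_simps)
    qed (use Suc.prems int YN in auto)
    have h2: "s * (\<Sum>i<N. \<nu> (Y i \<inter> (Z - ?Y))) \<le> u * \<nu> (Z - ?Y)"
    proof (rule Suc.IH)
      fix g assume g: "g \<in> Z - ?Y"
      then show "s * card {i. i < N \<and> g \<in> Y i} \<le> u"
        using Suc.prems(3)[of g] c2[of g] by simp
    qed (use Suc.prems diff YN in auto)
    have "\<nu> (Y i \<inter> Z) = \<nu> (Y i \<inter> (Z \<inter> ?Y)) + \<nu> (Y i \<inter> (Z - ?Y))" if "i < N" for i
      using split[OF int[of "Y i" Z] YN] Suc.prems that by (simp add: Int_assoc Int_Diff)
    then have "(\<Sum>i<N. \<nu> (Y i \<inter> Z)) = (\<Sum>i<N. \<nu> (Y i \<inter> (Z \<inter> ?Y))) + (\<Sum>i<N. \<nu> (Y i \<inter> (Z - ?Y)))"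
      by (simp add: sum.distrib[symmetric])
    then have "s * (\<Sum>i<Suc N. \<nu> (Y i \<inter> Z)) = s * (\<Sum>i<N. \<nu> (Y i \<inter> (Z \<inter> ?Y)))
        + s * (\<Sum>i<N. \<nu> (Y i \<inter> (Z - ?Y))) + s * \<nu> (Z \<inter> ?Y)"
      by (simp add: algebra_simps Int_commute)
    also have "\<dots> \<le> (u - s) * \<nu> (Z \<inter> ?Y) + u * \<nu> (Z - ?Y) + s * \<nu> (Z \<inter> ?Y)"
      using h1 h2 by linarith
    also have "\<dots> = u * \<nu> Z" using split[OF Suc.prems(2) YN] by (simp add: algebra_simps)
    finally show ?case .
  qed
qed

section \<open>Elementary extensions of ultraproducts of finite groups\<close>

locale pseudofinite_group =
  fixes ar :: "'f \<Rightarrow> nat" and rar :: "'r \<Rightarrow> nat" and mulS invS oneS :: 'f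
    and D :: "'i \<Rightarrow> 'a set" and F :: "'i \<Rightarrow> 'f \<Rightarrow> 'a list \<Rightarrow> 'a"
    and R :: "'i \<Rightarrow> 'r \<Rightarrow> 'a list \<Rightarrow> bool" and U :: "'i set set"
    and G :: "('g, 'h, 'f, 'r) pstruct"
    and hG :: "('i \<Rightarrow> 'a) set \<Rightarrow> 'g" and hI :: "('i \<Rightarrow> real) set \<Rightarrow> 'h"
  assumes lang: "group_lang ar mulS invS oneS"
    and fin_groups: "\<And>i. finite (D i) \<and> lstruct_ok ar (D i) (F i) \<and>
                         group_interp (D i) (F i) mulS invS oneS"
    and ultra: "ultrafilter_on U"
    and G_struct: "pstruct_ok ar rar G"
    and G_ext: "elem_emb ar rar (ultraprod D F R U) G hG hI"
begin

abbreviation "mulG x y \<equiv> fnG G mulS [x, y]"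
abbreviation "constI r \<equiv> hI (ucls U Ifun (\<lambda>_. r))"

lemma ar_mulS: "ar mulS = 2"
  using lang by (simp add: group_lang_def)

lemma closed_fin: "\<forall>x\<in>D i. \<forall>y\<in>D i. F i mulS [x, y] \<in> D i"
  using fin_groups[of i] ar_mulS by (simp add: lstruct_ok_def)

lemma closed_G: "\<forall>x\<in>domG G. \<forall>y\<in>domG G. mulG x y \<in> domG G"
  using G_struct ar_mulS by (simp add: pstruct_ok_def lstruct_ok_def)

lemma group_fin: "group \<lparr>carrier = D i, mult = (\<lambda>x y. F i mulS [x, y]), one = F i oneS []\<rparr>"
  using fin_groups[of i] by (simp add: group_interp_def group_of_def)

lemma transfer:
  assumes "wf_pfm ar rar \<psi>" "gfv \<psi> \<subseteq> {..<M}" "r \<in> {0..1}"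
    and "\<And>i e. range e \<subseteq> D i \<Longrightarrow> psat (fin_plus (D i) (F i) (R i)) e (\<lambda>_. r) \<psi>"
    and "range e \<subseteq> domG G"
  shows "psat G e (\<lambda>_. constI r) \<psi>"
  using psat_transfer[OF ultra _ _ G_ext assms] fin_groups by simp

lemma ex_env: "\<exists>e :: nat \<Rightarrow> 'g. range e \<subseteq> domG G"
proof -
  obtain x where "x \<in> domG G" using G_struct by (auto simp: pstruct_ok_def lstruct_ok_def)
  then have "range (\<lambda>_::nat. x) \<subseteq> domG G" by auto
  then show ?thesis by blast
qed

text \<open>Both cancellation laws together turn the set of all \<open>g\<close> with
  \<open>mulG b g\<close> in \<open>X\<close> into the left translate of \<open>X\<close> by
  \<open>c\<close>.\<close>

lemma left_inverse_G:
  assumes b: "b \<in> domG G"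
  shows "\<exists>c\<in>domG G. \<forall>x\<in>domG G. mulG b (mulG c x) = x \<and> mulG c (mulG b x) = x"
proof -
  let ?m = "\<lambda>s t. Fn mulS [s, t]"
  let ?\<psi> = "PExG 1 (PNeg (PExG 2 (PNeg (PConj
      (PEq (?m (Var 0) (?m (Var 1) (Var 2))) (Var 2)) (PEq (?m (Var 1) (?m (Var 0) (Var 2))) (Var 2))))))"
  have "psat G (\<lambda>_. b) (\<lambda>_. constI 0) ?\<psi>"
  proof (rule transfer)
    fix i and e :: "nat \<Rightarrow> 'a" assume e: "range e \<subseteq> D i"
    interpret group "\<lparr>carrier = D i, mult = (\<lambda>x y. F i mulS [x, y]), one = F i oneS []\<rparr>"
      by (rule group_fin)
    have e0: "e 0 \<in> D i" using e by auto
    obtain c where c: "c \<in> D i" "F i mulS [c, e 0] = F i oneS []" "F i mulS [e 0, c] = F i oneS []"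
      using e0 r_inv_ex[of "e 0"] l_inv_ex[of "e 0"] inv_closed[of "e 0"] l_inv[of "e 0"] r_inv[of "e 0"] by auto
    have "F i mulS [e 0, F i mulS [c, x]] = x \<and> F i mulS [c, F i mulS [e 0, x]] = x" if "x \<in> D i" for x
      using that c e0 m_assoc[of "e 0" c x] m_assoc[of c "e 0" x] l_one[of x] by simp
    then show "psat (fin_plus (D i) (F i) (R i)) e (\<lambda>_. 0) ?\<psi>" using c by (auto intro!: bexI[of _ c])
  next
    show "gfv ?\<psi> \<subseteq> {..<3}" by auto
  qed (use b ar_mulS in auto)
  then show ?thesis by simp
qed

text \<open>Makes a set one of its own left translates, so that it lies in the algebra along with
  them.\<close>

lemma left_one_G: "\<exists>u\<in>domG G. \<forall>x\<in>domG G. mulG u x = x"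
proof -
  let ?\<psi> = "PExG 0 (PNeg (PExG 1 (PNeg (PEq (Fn mulS [Var 0, Var 1]) (Var 1)))))"
  obtain e :: "nat \<Rightarrow> 'g" where e: "range e \<subseteq> domG G" using ex_env by (elim exE)
  have "psat G e (\<lambda>_. constI 0) ?\<psi>"
  proof (rule transfer)
    fix i and e :: "nat \<Rightarrow> 'a"
    interpret group "\<lparr>carrier = D i, mult = (\<lambda>x y. F i mulS [x, y]), one = F i oneS []\<rparr>"
      by (rule group_fin)
    have "F i oneS [] \<in> D i" "\<And>x. x \<in> D i \<Longrightarrow> F i mulS [F i oneS [], x] = x"
      using one_closed l_one by simp_all
    then show "psat (fin_plus (D i) (F i) (R i)) e (\<lambda>_. 0) ?\<psi>"
      by (simp del: One_nat_def) blast
  next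
    show "gfv ?\<psi> \<subseteq> {..<3}" by auto
  qed (use e ar_mulS in auto)
  then show ?thesis by simp
qed

text \<open>Of the density in a finite group only the side of \<open>r\<close> is known, so
  \<open>K\<close> has to admit the counts belonging to every real \<open>c\<close> on that
  side.\<close>

lemma uniform_count_transfer:
  fixes \<epsilon> r :: real and N k :: nat and e :: "nat \<Rightarrow> 'g" and \<phi> :: "('f, 'r) fm"
  assumes wf: "wf_fm ar rar \<phi>" and e: "range e \<subseteq> domG G"
    and ns: "\<not> shattering (domG G) mulG (\<lambda>x. satL (domG G) (fnG G) (relG G) (e(0 := x)) \<phi>) k"
    and r: "r \<in> {0..1}" and eps: "0 < \<epsilon>" "\<epsilon> \<le> 1" and N: "0 < N"
    and large: "ln (real (2 * (2 ^ k * (2 * N + 1) ^ (2 ^ k)))) < real N * \<epsilon>\<^sup>2 / 4"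
    and K: "\<And>(c::real) n. (t \<longleftrightarrow> c < r) \<Longrightarrow> \<bar>real n - N * c\<bar> \<le> N * \<epsilon> \<Longrightarrow> n \<in> K"
    and t: "t \<longleftrightarrow> lessI G (muI G \<phi> 1 (map e [1..<nfv \<phi>])) (constI r)"
  shows "uniform_count (domG G) mulG (\<lambda>x. satL (domG G) (fnG G) (relG G) (e(0 := x)) \<phi>) N K"
proof -
  \<comment> \<open>An implication in the available connectives. Finite groups with a shattered
    pattern of length \<open>k\<close>, or with a density on the other side of \<open>r\<close>,
    satisfy it vacuously, whereas G satisfies both premises.\<close>
  define \<psi> where "\<psi> = PNeg (PConj (PNeg (shattering_fm \<phi> mulS k))
    (PConj (PLit t (measure_less_fm \<phi>)) (PNeg (uniform_count_fm \<phi> mulS N K))))"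
  have "psat G e (\<lambda>_. constI r) \<psi>"
  proof (rule transfer[OF _ _ r _ e])
    show "wf_pfm ar rar \<psi>"
      using wf ar_mulS by (simp add: \<psi>_def shattering_fm_def uniform_count_fm_def wf_pfm_patterns_fm wf_pfm_measure_less_fm PLit_simps)
    show "gfv \<psi> \<subseteq> {..<nfv \<phi> + 1 + k + N}"
    proof -
      have "gfv (shattering_fm \<phi> mulS k) \<subseteq> {..<nfv \<phi> + 1 + k + N}" "gfv (uniform_count_fm \<phi> mulS N K) \<subseteq> {..<nfv \<phi> + 1 + k + N}"
        unfolding shattering_fm_def uniform_count_fm_def by (rule order_trans[OF gfv_patterns_fm], simp)+
      moreover have "gfv (measure_less_fm \<phi>) \<subseteq> {..<nfv \<phi> + 1 + k + N}" by (rule order_trans[OF gfv_measure_less_fm]) simp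
      ultimately show ?thesis by (simp add: \<psi>_def PLit_simps)
    qed
  next
    fix i and e :: "nat \<Rightarrow> 'a" assume "range e \<subseteq> D i"
    let ?X = "\<lambda>x. satL (D i) (F i) (R i) (e(0 := x)) \<phi>" and ?S = "fin_plus (D i) (F i) (R i)"
    have cl: "\<forall>x\<in>domG ?S. \<forall>y\<in>domG ?S. fnG ?S mulS [x, y] \<in> domG ?S" using closed_fin by simp
    have "uniform_count (D i) (\<lambda>x y. F i mulS [x, y]) ?X N K"
      if "\<not> shattering (D i) (\<lambda>x y. F i mulS [x, y]) ?X k" "t \<longleftrightarrow> card {x\<in>D i. ?X x} / card (D i) < r"
      by (rule finite_group_uniform_count[OF group_fin _ that(1) eps N large])
        (use fin_groups K[OF that(2)] in auto)
    then show "psat ?S e (\<lambda>_. r) \<psi>"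
      unfolding \<psi>_def psat.simps PLit_simps psat_shattering_fm[OF cl] psat_uniform_count_fm[OF cl] psat_measure_less_fm
        fin_plus_simps fin_mu_eq by blast
  qed
  then show ?thesis
    unfolding \<psi>_def psat.simps PLit_simps psat_shattering_fm[OF closed_G] psat_uniform_count_fm[OF closed_G] psat_measure_less_fm
    using ns t by blast
qed

text \<open>Puts 0 into the set whose supremum is the standard part, so that this supremum is not
  taken over the empty set.\<close>

lemma not_less_constI_0:
  assumes wf: "wf_fm ar rar \<phi>" and e: "range e \<subseteq> domG G"
  shows "\<not> lessI G (muI G \<phi> 1 (map e [1..<nfv \<phi>])) (constI 0)"
proof -
  have "psat G e (\<lambda>_. constI 0) (PNeg (measure_less_fm \<phi>))"
  proof (rule transfer[OF _ _ _ _ e])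
    show "wf_pfm ar rar (PNeg (measure_less_fm \<phi>))" using wf by (simp add: wf_pfm_measure_less_fm)
    show "gfv (PNeg (measure_less_fm \<phi>)) \<subseteq> {..<nfv \<phi>}" by (simp add: gfv_measure_less_fm)
  next
    fix i and e :: "nat \<Rightarrow> 'a"
    show "psat (fin_plus (D i) (F i) (R i)) e (\<lambda>_. 0) (PNeg (measure_less_fm \<phi>))"
      using fin_mu_bounds(1)[of "D i"] fin_groups[of i] by (simp add: psat_measure_less_fm not_less)
  qed simp
  then show ?thesis by (simp add: psat_measure_less_fm)
qed

text \<open>If \<open>a\<^sub>0, \<dots>, a\<^sub>N\<^sub>-\<^sub>1\<close> witness uniformity, then the sum of the indicators of the
  translates \<open>a\<^sub>i\<^sup>-\<^sup>1 X\<close> is nearly constant, and \<open>\<nu>\<close> integrates it to \<open>N \<cdot> \<nu> X\<close>.\<close>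

lemma measure_of_uniform_count:
  fixes s u :: real
  assumes alg: "bool_alg (domG G) \<B>" and prob: "fin_add_prob (domG G) \<B> \<nu>"
    and X: "X \<subseteq> domG G" "X \<in> \<B>" and translates: "\<And>g. g \<in> domG G \<Longrightarrow> ltrans G mulS g X \<in> \<B>"
    and inv: "\<And>g. g \<in> domG G \<Longrightarrow> \<nu> (ltrans G mulS g X) = \<nu> X"
    and uc: "uniform_count (domG G) mulG (\<lambda>x. x \<in> X) N K" and N: "0 < N"
    and K: "\<And>n. n \<in> K \<Longrightarrow> s * real n \<le> N * u"
  shows "s * \<nu> X \<le> u"
proof -
  obtain a where a: "\<And>i. i < N \<Longrightarrow> a i \<in> domG G"
    "\<And>g. g \<in> domG G \<Longrightarrow> card {i. i < N \<and> mulG (a i) g \<in> X} \<in> K"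
    using uc by (auto simp: uniform_count_def)
  have "\<exists>c. i < N \<longrightarrow> c \<in> domG G \<and> (\<forall>x\<in>domG G. mulG (a i) (mulG c x) = x \<and> mulG c (mulG (a i) x) = x)" for i
    using left_inverse_G[OF a(1)] by blast
  then obtain c where c: "\<And>i. i < N \<Longrightarrow> c i \<in> domG G"
    "\<And>i x. i < N \<Longrightarrow> x \<in> domG G \<Longrightarrow> mulG (a i) (mulG (c i) x) = x \<and> mulG (c i) (mulG (a i) x) = x"
    by metis
  define Y where "Y i = ltrans G mulS (c i) X" for i
  have mem: "g \<in> Y i \<longleftrightarrow> mulG (a i) g \<in> X" if "i < N" "g \<in> domG G" for g i
  proof
    assume "g \<in> Y i"
    then obtain x where "x \<in> X" "g = mulG (c i) x" by (auto simp: Y_def ltrans_def)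
    then show "mulG (a i) g \<in> X" using c(2)[OF that(1), of x] X by auto
  next
    assume "mulG (a i) g \<in> X"
    then have "mulG (c i) (mulG (a i) g) \<in> Y i" by (auto simp: Y_def ltrans_def)
    then show "g \<in> Y i" using c(2)[OF that] by simp
  qed
  have YB: "Y i \<in> \<B>" "\<nu> (Y i) = \<nu> X" if "i < N" for i
    using translates inv c(1)[OF that] by (auto simp: Y_def)
  have sub: "Y i \<inter> domG G = Y i" if "i < N" for i
    using YB(1)[OF that] alg by (auto simp: bool_alg_def)
  have "s * (\<Sum>i<N. \<nu> (Y i \<inter> domG G)) \<le> (N * u) * \<nu> (domG G)"
  proof (rule sum_measure_scaled_le[OF alg prob])
    show "domG G \<in> \<B>" using alg unfolding bool_alg_def by (metis Diff_empty)
    fix g assume g: "g \<in> domG G"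
    have "{i. i < N \<and> g \<in> Y i} = {i. i < N \<and> mulG (a i) g \<in> X}" using mem g by auto
    then show "s * card {i. i < N \<and> g \<in> Y i} \<le> N * u" using K a(2)[OF g] by simp
  qed (rule YB(1))
  moreover have "(\<Sum>i<N. \<nu> (Y i \<inter> domG G)) = N * \<nu> X" using sub YB(2) by simp
  moreover have "\<nu> (domG G) = 1" using prob by (simp add: fin_add_prob_def)
  ultimately have "N * (s * \<nu> X) \<le> N * u" by (simp add: mult.left_commute)
  then show ?thesis using N by simp
qed

text \<open>Two thresholds decide: some \<open>r\<close> in \<open>A\<close> lies just below
  \<open>m\<close> and restricts attention to densities that are at least \<open>r\<close>, while
  \<open>m + \<epsilon> / 2\<close> is outside \<open>A\<close> and restricts it to densities below
  it.\<close>

lemma nip_measure_eq_pf_measure: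
  fixes \<phi> :: "('f, 'r) fm"
  assumes wf: "wf_fm ar rar \<phi>" and e: "range e \<subseteq> domG G"
    and NIP: "NIP_rel (domG G) (\<lambda>x y. satL (domG G) (fnG G) (relG G) (e(0 := fnG G mulS [y, x])) \<phi>)"
    and alg: "bool_alg (domG G) \<B>"
    and translates: "\<forall>g\<in>domG G. ltrans G mulS g (defset G \<phi> e) \<in> \<B>"
    and prob: "fin_add_prob (domG G) \<B> \<nu>"
    and left_inv: "\<forall>g\<in>domG G. \<forall>X\<in>\<B>. ltrans G mulS g X \<in> \<B> \<longrightarrow> \<nu> (ltrans G mulS g X) = \<nu> X"
  shows "\<nu> (defset G \<phi> e) = pf_measure G U hI \<phi> e"
proof -
  let ?P = "\<lambda>x. satL (domG G) (fnG G) (relG G) (e(0 := x)) \<phi>"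
  define X where "X = defset G \<phi> e"
  define t where "t = muI G \<phi> 1 (map e [1..<nfv \<phi>])"
  define A where "A = {r \<in> {0..1}. \<not> lessI G t (constI r)}"
  define m where "m = Sup A"
  have pf: "pf_measure G U hI \<phi> e = m"
    by (simp add: pf_measure_def std_part_def m_def A_def t_def)
  have XD: "X \<subseteq> domG G" by (auto simp: X_def defset_def)
  have memX: "x \<in> X \<longleftrightarrow> ?P x" if "x \<in> domG G" for x using that by (simp add: X_def defset_def)
  obtain k where ns: "\<not> shattering (domG G) mulG ?P k"
  proof -
    from NIP[unfolded NIP_rel_def] obtain k :: nat where k: "\<not> (\<exists>a b. (\<forall>i<k. a i \<in> domG G) \<and> (\<forall>J. J \<subseteq> {..<k} \<longrightarrow> b J \<in> domG G) \<and>
      (\<forall>i<k. \<forall>J. J \<subseteq> {..<k} \<longrightarrow> (?P (mulG (b J) (a i)) \<longleftrightarrow> i \<in> J)))"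
      by (elim exE) (erule that)
    have "\<not> shattering (domG G) mulG ?P k"
    proof
      assume "shattering (domG G) mulG ?P k"
      then obtain a where a: "\<forall>i<k. a i \<in> domG G"
        "\<forall>J\<subseteq>{..<k}. \<exists>b\<in>domG G. \<forall>i<k. i \<in> J \<longleftrightarrow> ?P (mulG b (a i))"
        unfolding shattering_def by blast
      have "\<forall>J. \<exists>b. J \<subseteq> {..<k} \<longrightarrow> b \<in> domG G \<and> (\<forall>i<k. i \<in> J \<longleftrightarrow> ?P (mulG b (a i)))"
        using a(2) by blast
      from choice[OF this] obtain b where
        "\<forall>J. J \<subseteq> {..<k} \<longrightarrow> b J \<in> domG G \<and> (\<forall>i<k. i \<in> J \<longleftrightarrow> ?P (mulG (b J) (a i)))" by blast
      then have b: "b J \<in> domG G" "i < k \<Longrightarrow> ?P (mulG (b J) (a i)) \<longleftrightarrow> i \<in> J" if "J \<subseteq> {..<k}" for i J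
        using that by simp_all
      have "(\<forall>i<k. a i \<in> domG G) \<and> (\<forall>J. J \<subseteq> {..<k} \<longrightarrow> b J \<in> domG G) \<and>
          (\<forall>i<k. \<forall>J. J \<subseteq> {..<k} \<longrightarrow> (?P (mulG (b J) (a i)) \<longleftrightarrow> i \<in> J))"
        using a(1) b by (intro conjI allI impI) simp_all
      with k[unfolded not_ex, THEN spec, of a, THEN spec, of b] show False by (rule notE)
    qed
    then show ?thesis by (rule that)
  qed
  have XB: "X \<in> \<B>"
  proof -
    obtain u where u: "u \<in> domG G" "\<forall>x\<in>domG G. mulG u x = x" using left_one_G by blast
    then have "ltrans G mulS u X = X" using XD by (force simp: ltrans_def)
    then show ?thesis using translates u(1) by (metis X_def)
  qed
  have tr: "ltrans G mulS g X \<in> \<B>" and inv: "\<nu> (ltrans G mulS g X) = \<nu> X" if "g \<in> domG G" for g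
    using translates left_inv XB that by (auto simp: X_def)
  \<comment> \<open>Used with \<open>s = 1\<close> for the upper and \<open>s = -1\<close> for the
    lower bound. The size \<open>N\<close> is chosen inside, depending on \<epsilon>, so
    \<open>bnd\<close> is demanded for every \<open>N\<close>.\<close>
  have approx: "s * \<nu> X \<le> u"
    if eps: "0 < \<epsilon>" "\<epsilon> \<le> 1" and r: "r \<in> {0..1}"
      and bnd: "\<And>(c::real) (n::nat) (N::nat). (lessI G t (constI r) \<longleftrightarrow> c < r) \<Longrightarrow> \<bar>real n - real N * c\<bar> \<le> N * \<epsilon> \<Longrightarrow> s * real n \<le> N * u"
    for \<epsilon> r s u :: real
  proof -
    obtain N :: nat where N: "N > 0" "ln (real (2 * (2 ^ k * (2 * N + 1) ^ (2 ^ k)))) < real N * \<epsilon>\<^sup>2 / 4"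
      using uniform_sample_size_exists[OF eps(1), of "2 ^ k"] by blast
    have "uniform_count (domG G) mulG ?P N {n. s * real n \<le> N * u}"
      by (rule uniform_count_transfer[OF wf e ns r eps N, of "lessI G t (constI r)"])
        (auto simp: t_def intro: bnd)
    moreover have "uniform_count (domG G) mulG ?P N {n. s * real n \<le> N * u} \<Longrightarrow>
      uniform_count (domG G) mulG (\<lambda>x. x \<in> X) N {n. s * real n \<le> N * u}"
    proof -
      assume "uniform_count (domG G) mulG ?P N {n. s * real n \<le> N * u}"
      then obtain a where a: "\<forall>i<N. a i \<in> domG G"
        "\<forall>g\<in>domG G. card {i. i < N \<and> ?P (mulG (a i) g)} \<in> {n. s * real n \<le> N * u}"
        unfolding uniform_count_def by blast
      have "{i. i < N \<and> ?P (mulG (a i) g)} = {i. i < N \<and> mulG (a i) g \<in> X}"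
        if "g \<in> domG G" for g
        using memX closed_G that a(1) by blast
      then show ?thesis unfolding uniform_count_def using a by auto
    qed
    ultimately have uc: "uniform_count (domG G) mulG (\<lambda>x. x \<in> X) N {n. s * real n \<le> N * u}" by blast
    show ?thesis
      by (rule measure_of_uniform_count[OF alg prob XD XB _ _ uc N(1)]) (simp_all add: tr inv)
  qed
  have A0: "0 \<in> A" using not_less_constI_0[OF wf e] by (simp add: A_def t_def)
  have bdd: "bdd_above A" by (rule bdd_aboveI[of _ 1]) (simp add: A_def)
  have m01: "0 \<le> m" "m \<le> 1"
    unfolding m_def using A0 bdd by (auto intro: cSup_upper cSup_least simp: A_def)
  have "\<nu> X \<le> 1"
  proof -
    have "domG G - X \<in> \<B>" "X \<inter> (domG G - X) = {}" using alg XB by (auto simp: bool_alg_def)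
    then have "\<nu> (X \<union> (domG G - X)) = \<nu> X + \<nu> (domG G - X)" "0 \<le> \<nu> (domG G - X)" "\<nu> (domG G) = 1"
      using prob XB unfolding fin_add_prob_def by blast+
    moreover have "X \<union> (domG G - X) = domG G" using XD by auto
    ultimately show ?thesis by simp
  qed
  have close: "m - \<epsilon> \<le> \<nu> X \<and> \<nu> X \<le> m + \<epsilon>" if eps: "0 < \<epsilon>" "\<epsilon> \<le> 1" for \<epsilon>
  proof
    obtain r where r: "r \<in> A" "m - \<epsilon> / 2 < r"
      using less_cSupD[of A "m - \<epsilon> / 2"] A0 eps by (auto simp: m_def)
    have "-1 * \<nu> X \<le> - (r - \<epsilon> / 2)"
    proof (rule approx[of "\<epsilon> / 2" r])
      fix c :: real and n N :: nat
      assume c: "lessI G t (constI r) \<longleftrightarrow> c < r" and n: "\<bar>real n - real N * c\<bar> \<le> N * (\<epsilon> / 2)"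
      have "r \<le> c" using c r(1) by (simp add: A_def)
      then have "N * r \<le> N * c" by (simp add: mult_left_mono)
      then have "N * r - N * (\<epsilon> / 2) \<le> n" using n by linarith
      then show "-1 * real n \<le> N * - (r - \<epsilon> / 2)" by (simp add: right_diff_distrib)
    qed (use eps r in \<open>auto simp: A_def\<close>)
    then show "m - \<epsilon> \<le> \<nu> X" using r by simp
    show "\<nu> X \<le> m + \<epsilon>"
    \<comment> \<open>A threshold must lie in [0,1] to name an element of sort I; past 1 the claim
      follows from \<open>\<nu> X \<le> 1\<close>.\<close>
    proof (cases "m + \<epsilon> / 2 \<le> 1")
      case True
      let ?r = "m + \<epsilon> / 2"
      have r: "?r \<in> {0..1}" using True m01 eps by simp
      have "?r \<notin> A" using cSup_upper[OF _ bdd, of ?r] eps by (auto simp: m_def)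
      then have less: "lessI G t (constI ?r)" using r by (simp add: A_def)
      have "1 * \<nu> X \<le> ?r + \<epsilon> / 2"
      proof (rule approx[of "\<epsilon> / 2" ?r])
        fix c :: real and n N :: nat
        assume c: "lessI G t (constI ?r) \<longleftrightarrow> c < ?r" and n: "\<bar>real n - real N * c\<bar> \<le> N * (\<epsilon> / 2)"
        have "c \<le> ?r" using c less by simp
        then have "N * c \<le> N * ?r" by (simp add: mult_left_mono)
        then have "n \<le> N * ?r + N * (\<epsilon> / 2)" using n by linarith
        then show "1 * real n \<le> N * (?r + \<epsilon> / 2)" by (simp only: distrib_left mult_1)
      qed (use eps r in auto)
      then show ?thesis by simp
    next
      case False
      then show ?thesis using \<open>\<nu> X \<le> 1\<close> eps by linarith
    qed
  qed
  have "\<nu> X = m"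
  proof (rule ccontr)
    assume "\<nu> X \<noteq> m"
    \<comment> \<open>Half the distance is small enough to contradict \<open>close\<close>; the
      minimum with 1 meets its condition \<open>\<epsilon> \<le> 1\<close>.\<close>
    then have "0 < min 1 (\<bar>\<nu> X - m\<bar> / 2)" "min 1 (\<bar>\<nu> X - m\<bar> / 2) \<le> 1" by auto
    from close[OF this] have "m - min 1 (\<bar>\<nu> X - m\<bar> / 2) \<le> \<nu> X" "\<nu> X \<le> m + min 1 (\<bar>\<nu> X - m\<bar> / 2)"
      by simp_all
    moreover have "min 1 (\<bar>\<nu> X - m\<bar> / 2) \<le> \<bar>\<nu> X - m\<bar> / 2" by (rule min.cobounded2)
    ultimately have "\<bar>\<nu> X - m\<bar> \<le> \<bar>\<nu> X - m\<bar> / 2" by linarith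
    then show False using \<open>\<nu> X \<noteq> m\<close> by simp
  qed
  then show ?thesis by (simp add: pf X_def)
qed

end

theorem theorem5p9:
  fixes ar :: "'f \<Rightarrow> nat" and rar :: "'r \<Rightarrow> nat" and mulS invS oneS :: 'f
    and D :: "'i \<Rightarrow> 'a set" and F :: "'i \<Rightarrow> 'f \<Rightarrow> 'a list \<Rightarrow> 'a"
    and R :: "'i \<Rightarrow> 'r \<Rightarrow> 'a list \<Rightarrow> bool" and U :: "'i set set"
    and G :: "('g, 'h, 'f, 'r) pstruct"
    and hG :: "('i \<Rightarrow> 'a) set \<Rightarrow> 'g" and hI :: "('i \<Rightarrow> real) set \<Rightarrow> 'h"
    and \<phi> :: "('f, 'r) fm" and e :: "nat \<Rightarrow> 'g"
    and \<B> :: "'g set set" and \<nu> :: "'g set \<Rightarrow> real"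
  assumes lang: "group_lang ar mulS invS oneS"
    and fin_groups: "\<forall>i. finite (D i) \<and> lstruct_ok ar (D i) (F i) \<and>
                         group_interp (D i) (F i) mulS invS oneS"
    and ultra: "ultrafilter_on U"
    and G_struct: "pstruct_ok ar rar G"
    and G_ext: "elem_emb ar rar (ultraprod D F R U) G hG hI"
    and G_sat: "saturated ar rar G"
    and phi_wf: "wf_fm ar rar \<phi>"
    and params: "range e \<subseteq> domG G"
    and NIP: "NIP_rel (domG G) (\<lambda>x y. satL (domG G) (fnG G) (relG G) (e(0 := fnG G mulS [y, x])) \<phi>)"
    and alg: "bool_alg (domG G) \<B>"
    and translates: "\<forall>g\<in>domG G. ltrans G mulS g (defset G \<phi> e) \<in> \<B>"
    and prob: "fin_add_prob (domG G) \<B> \<nu>"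
    and left_inv: "\<forall>g\<in>domG G. \<forall>X\<in>\<B>. ltrans G mulS g X \<in> \<B> \<longrightarrow> \<nu> (ltrans G mulS g X) = \<nu> X"
  shows "\<nu> (defset G \<phi> e) = pf_measure G U hI \<phi> e"
proof -
  interpret pseudofinite_group ar rar mulS invS oneS D F R U G hG hI
    by unfold_locales (use lang fin_groups ultra G_struct G_ext in simp_all)
  show ?thesis
    by (rule nip_measure_eq_pf_measure[OF phi_wf params NIP alg translates prob left_inv])
qed

end
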